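(* Let $R$ be a Noetherian ring and let $\mathfrak{c}$ be a filtered Floer-Novikov complex over $R$, with Floer chain complex $(C_*(\mathfrak{c}),\partial)$, homology $H_*(\mathfrak{c})$, filtration function $\ell\colon C_*(\mathfrak{c})\to\mathbb{R}\cup\{-\infty\}$ and spectral numbers $\rho(a)$, $a\in H_*(\mathfrak{c})$. Then for every $a\in H_*(\mathfrak{c})$ there is $\alpha\in C_*(\mathfrak{c})$ such that $[\alpha]=a$ (i.e. $\alpha$ is a cycle representing $a$) and $$\ell(\alpha)=\rho(a).$$
   Context: Rings are commutative with unit. A filtered Floer-Novikov complex $\mathfrak{c}$ over a ring $R$ consists of the following data. (1) A principal $\Gamma$-bundle $P\to S$ (discrete topology), where $S$ is a finite set and $\Gamma$ is a finitely generated abelian group written multiplicatively; i.e. $P$ is a set with a free $\Gamma$-action whose orbit set is identified with the finite set $S$. (2) An "action functional" $\mathcal{A}\colon P\to\mathbb{R}$ and a "period homomorphism" (group homomorphism) $\omega\colon\Gamma\to\mathbb{R}$ satisfying $\mathcal{A}(g\cdot p)=\mathcal{A}(p)-\omega(g)$ for all $g\in\Gamma$, $p\in P$. (3) A map $n\colon P\times P\to R$ such that: (i) $n(p,p')=0$ unless $\mathcal{A}(p)>\mathcal{A}(p')$; (ii) $n(g\cdot p,g\cdot p')=n(p,p')$ for all $p,p'\in P$, $g\in\Gamma$; (iii) for each $p\in P$ the formal sum $\partial p=\sum_{q\in P}n(p,q)q$ belongs to the Floer chain complex $$C_*(\mathfrak{c})=\Big\{\sum_{q\in P}a_q q \;\Big|\;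 a_q\in R,\ (\forall C\in\mathbb{R})(\#\{q\mid a_q\neq 0,\ \mathcal{A}(q)>C\}<\infty)\Big\};$$ (iv) with the Novikov ring $$\Lambda_{\Gamma,\omega}=\Big\{\sum_{g\in\Gamma}b_g g\;\Big|\; b_g\in R,\ (\forall C\in\mathbb{R})(\#\{g\mid b_g\neq 0,\ \omega(g)<C\}<\infty)\Big\},$$ over which $C_*(\mathfrak{c})$ is a module in the obvious way via the $\Gamma$-action on $P$, the map $\partial\colon P\to C_*(\mathfrak{c})$ of (iii) extends to a $\Lambda_{\Gamma,\omega}$-module homomorphism $\partial\colon C_*(\mathfrak{c})\to C_*(\mathfrak{c})$ with $\partial\circ\partial=0$. Homology: $H_*(\mathfrak{c})=\ker\partial/\operatorname{Im}\partial$. For $c=\sum_{p}c_p p\in C_*(\mathfrak{c})$ nonzero, $\ell(c)=\max\{\mathcal{A}(p)\mid c_p\neq 0\}$ (the maximum exists), and $\ell(0)=-\infty$. For $\lambda\in\mathbb{R}$, $C_*^\lambda(\mathfrak{c})=\{c\in C_*(\mathfrak{c})\mid \ell(c)\le\lambda\}$; by (3)(i) it is preserved by $\partial$, and $H_*^\lambda(\mathfrak{c})$ denotes its homology, with inclusion-induced map $\iota_*\colon H_*^\lambda(\mathfrak{c})\to H_*(\mathfrak{c})$. The spectral number of $a\in H_*(\mathfrak{c})$ is $$\rho(a)=\inf\{\lambda\in\mathbb{R}\mid a\in\operatorname{Im}(\iota_*\colon H_*^\lambda(\mathfrak{c})\to H_*(\mathfrak{c}))\}=\inf\{\ell(c)\mid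 c\in C_*(\mathfrak{c}),\ [c]=a\},$$ where $[c]$ denotes the homology class of the cycle $c$. *)

theory Defs
  imports "HOL-Algebra.Algebra" "HOL-Library.Extended_Real"
begin

text \<open>
  A formal sum $\sum_{x \in X} a_x x$ with coefficients in \<open>R\<close> is the extensional function
  \<open>x \<mapsto> a_x\<close> in \<open>X \<rightarrow>\<^sub>E carrier R\<close>, so that equality of formal sums is equality of functions.
\<close>

record ('r, 'g, 's, 'p) floer_novikov =
  gam :: "'g monoid"                 \<comment> \<open>the group \<open>\<Gamma>\<close>\<close>
  base :: "'s set"                   \<comment> \<open>the finite set \<open>S\<close>\<close>
  points :: "'p set"                 \<comment> \<open>the set \<open>P\<close>\<close>
  bproj :: "'p \<Rightarrow> 's"                 \<comment> \<open>the bundle projection \<open>P \<rightarrow> S\<close>\<close>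
  act :: "'g \<Rightarrow> 'p \<Rightarrow> 'p"
  action :: "'p \<Rightarrow> real"             \<comment> \<open>the action functional\<close>
  period :: "'g \<Rightarrow> real"             \<comment> \<open>the period homomorphism \<open>\<omega>\<close>\<close>
  ncoeff :: "'p \<Rightarrow> 'p \<Rightarrow> 'r"         \<comment> \<open>the map \<open>n\<close>\<close>

definition principal_bundle ::
  "'g monoid \<Rightarrow> 's set \<Rightarrow> 'p set \<Rightarrow> ('p \<Rightarrow> 's) \<Rightarrow> ('g \<Rightarrow> 'p \<Rightarrow> 'p) \<Rightarrow> bool" where
  "principal_bundle G S P \<pi> \<phi> \<longleftrightarrow>
     group_action G P \<phi> \<and>
     (\<forall>g\<in>carrier G. \<forall>p\<in>P. \<phi> g p = p \<longrightarrow> g = \<one>\<^bsub>G\<^esub>) \<and>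
     \<pi> ` P = S \<and>
     (\<forall>p\<in>P. \<forall>q\<in>P. \<pi> p = \<pi> q \<longleftrightarrow> q \<in> orbit G \<phi> p)"

text \<open>
  The set over which each sum below ranges is finite (by the Novikov conditions); it is cut down to
  the nonzero terms because \<open>finsum\<close> is only meaningful on finite index sets.
\<close>

definition novikov_ring ::
  "('r, 'm) ring_scheme \<Rightarrow> 'g monoid \<Rightarrow> ('g \<Rightarrow> real) \<Rightarrow> ('g \<Rightarrow> 'r) ring" where
  "novikov_ring R G \<omega> =
     \<lparr> carrier = {b \<in> carrier G \<rightarrow>\<^sub>E carrier R.
          \<forall>C. finite {g \<in> carrier G. b g \<noteq> \<zero>\<^bsub>R\<^esub> \<and> \<omega> g < C}},
       monoid.mult = (\<lambda>a b. \<lambda>g\<in>carrier G.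
          \<Oplus>\<^bsub>R\<^esub>h\<in>{h \<in> carrier G. a h \<noteq> \<zero>\<^bsub>R\<^esub> \<and> b (inv\<^bsub>G\<^esub> h \<otimes>\<^bsub>G\<^esub> g) \<noteq> \<zero>\<^bsub>R\<^esub>}.
            a h \<otimes>\<^bsub>R\<^esub> b (inv\<^bsub>G\<^esub> h \<otimes>\<^bsub>G\<^esub> g)),
       monoid.one = (\<lambda>g\<in>carrier G. if g = \<one>\<^bsub>G\<^esub> then \<one>\<^bsub>R\<^esub> else \<zero>\<^bsub>R\<^esub>),
       ring.zero = (\<lambda>g\<in>carrier G. \<zero>\<^bsub>R\<^esub>),
       ring.add = (\<lambda>a b. \<lambda>g\<in>carrier G. a g \<oplus>\<^bsub>R\<^esub> b g) \<rparr>"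

text \<open>
  The chain complex as a module over the Novikov ring.  The scalar multiplication is
  $(\sum_g b_g g) \cdot (\sum_p x_p p) = \sum_{g,p} b_g x_p (g \cdot p)$, read off at \<open>q = g \<cdot> p\<close>.
  The ring-only fields \<open>mult\<close> and \<open>one\<close> of the record type are not used for modules.
\<close>

definition floer_chains ::
  "('r, 'm) ring_scheme \<Rightarrow> ('r, 'g, 's, 'p) floer_novikov \<Rightarrow> ('g \<Rightarrow> 'r, 'p \<Rightarrow> 'r) module" where
  "floer_chains R c =
     \<lparr> carrier = {x \<in> points c \<rightarrow>\<^sub>E carrier R.
          \<forall>C. finite {q \<in> points c. x q \<noteq> \<zero>\<^bsub>R\<^esub> \<and> action c q > C}},
       monoid.mult = undefined,
       monoid.one = undefined,
       ring.zero = (\<lambda>q\<in>points c. \<zero>\<^bsub>R\<^esub>),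
       ring.add = (\<lambda>x y. \<lambda>q\<in>points c. x q \<oplus>\<^bsub>R\<^esub> y q),
       smult = (\<lambda>b x. \<lambda>q\<in>points c.
          \<Oplus>\<^bsub>R\<^esub>g\<in>{g \<in> carrier (gam c).
                    b g \<noteq> \<zero>\<^bsub>R\<^esub> \<and> x (act c (inv\<^bsub>gam c\<^esub> g) q) \<noteq> \<zero>\<^bsub>R\<^esub>}.
            b g \<otimes>\<^bsub>R\<^esub> x (act c (inv\<^bsub>gam c\<^esub> g) q)) \<rparr>"

definition floer_generator ::
  "('r, 'm) ring_scheme \<Rightarrow> ('r, 'g, 's, 'p) floer_novikov \<Rightarrow> 'p \<Rightarrow> ('p \<Rightarrow> 'r)" where
  "floer_generator R c p = (\<lambda>q\<in>points c. if q = p then \<one>\<^bsub>R\<^esub> else \<zero>\<^bsub>R\<^esub>)"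

definition generator_boundary :: "('r, 'g, 's, 'p) floer_novikov \<Rightarrow> 'p \<Rightarrow> ('p \<Rightarrow> 'r)" where
  "generator_boundary c p = (\<lambda>q\<in>points c. ncoeff c p q)"

definition module_homs ::
  "('a, 'm) ring_scheme \<Rightarrow> ('a, 'b) module \<Rightarrow> ('a, 'c) module \<Rightarrow> ('b \<Rightarrow> 'c) set" where
  "module_homs L M N =
     {D \<in> carrier M \<rightarrow> carrier N.
        (\<forall>x\<in>carrier M. \<forall>y\<in>carrier M. D (x \<oplus>\<^bsub>M\<^esub> y) = D x \<oplus>\<^bsub>N\<^esub> D y) \<and>
        (\<forall>b\<in>carrier L. \<forall>x\<in>carrier M. D (b \<odot>\<^bsub>M\<^esub> x) = b \<odot>\<^bsub>N\<^esub> D x)}"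

definition is_floer_boundary ::
  "('r, 'm) ring_scheme \<Rightarrow> ('r, 'g, 's, 'p) floer_novikov \<Rightarrow> (('p \<Rightarrow> 'r) \<Rightarrow> ('p \<Rightarrow> 'r)) \<Rightarrow> bool" where
  "is_floer_boundary R c D \<longleftrightarrow>
     D \<in> module_homs (novikov_ring R (gam c) (period c)) (floer_chains R c) (floer_chains R c) \<and>
     (\<forall>p\<in>points c. D (floer_generator R c p) = generator_boundary c p) \<and>
     (\<forall>x\<in>carrier (floer_chains R c). D (D x) = \<zero>\<^bsub>floer_chains R c\<^esub>)"

definition filtered_floer_novikov_complex ::
  "('r, 'm) ring_scheme \<Rightarrow> ('r, 'g, 's, 'p) floer_novikov \<Rightarrow> bool" where
  "filtered_floer_novikov_complex R c \<longleftrightarrow>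
     comm_group (gam c) \<and>
     (\<exists>A. finite A \<and> A \<subseteq> carrier (gam c) \<and> generate (gam c) A = carrier (gam c)) \<and>
     finite (base c) \<and>
     principal_bundle (gam c) (base c) (points c) (bproj c) (act c) \<and>
     (\<forall>g\<in>carrier (gam c). \<forall>h\<in>carrier (gam c).
        period c (g \<otimes>\<^bsub>gam c\<^esub> h) = period c g + period c h) \<and>
     (\<forall>g\<in>carrier (gam c). \<forall>p\<in>points c. action c (act c g p) = action c p - period c g) \<and>
     (\<forall>p\<in>points c. \<forall>q\<in>points c. ncoeff c p q \<in> carrier R) \<and>
     (\<forall>p\<in>points c. \<forall>q\<in>points c. \<not> action c p > action c q \<longrightarrow> ncoeff c p q = \<zero>\<^bsub>R\<^esub>) \<and>
     (\<forall>g\<in>carrier (gam c). \<forall>p\<in>points c. \<forall>q\<in>points c.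
        ncoeff c (act c g p) (act c g q) = ncoeff c p q) \<and>
     (\<forall>p\<in>points c. generator_boundary c p \<in> carrier (floer_chains R c)) \<and>
     (\<exists>D. is_floer_boundary R c D)"

text \<open>
  The generators of one point in each orbit form a finite basis of the chain complex over the
  Novikov ring, so the extension chosen here is unique on the chain complex.
\<close>

definition floer_boundary ::
  "('r, 'm) ring_scheme \<Rightarrow> ('r, 'g, 's, 'p) floer_novikov \<Rightarrow> ('p \<Rightarrow> 'r) \<Rightarrow> ('p \<Rightarrow> 'r)" where
  "floer_boundary R c = (SOME D. is_floer_boundary R c D)"

definition subcomplex_homology ::
  "('r, 'm) ring_scheme \<Rightarrow> ('r, 'g, 's, 'p) floer_novikov \<Rightarrow> ('p \<Rightarrow> 'r) set \<Rightarrow> ('p \<Rightarrow> 'r) set monoid"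
  where
  "subcomplex_homology R c U =
     A_FactGroup
       (floer_chains R c
          \<lparr>carrier := {x \<in> U. floer_boundary R c x = \<zero>\<^bsub>floer_chains R c\<^esub>}\<rparr>)
       (floer_boundary R c ` U)"

definition floer_homology ::
  "('r, 'm) ring_scheme \<Rightarrow> ('r, 'g, 's, 'p) floer_novikov \<Rightarrow> ('p \<Rightarrow> 'r) set monoid" where
  "floer_homology R c = subcomplex_homology R c (carrier (floer_chains R c))"

definition floer_class ::
  "('r, 'm) ring_scheme \<Rightarrow> ('r, 'g, 's, 'p) floer_novikov \<Rightarrow> ('p \<Rightarrow> 'r) \<Rightarrow> ('p \<Rightarrow> 'r) set" where
  "floer_class R c x =
     (floer_boundary R c ` carrier (floer_chains R c)) +>\<^bsub>floer_chains R c\<^esub> x"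

definition floer_level ::
  "('r, 'm) ring_scheme \<Rightarrow> ('r, 'g, 's, 'p) floer_novikov \<Rightarrow> ('p \<Rightarrow> 'r) \<Rightarrow> ereal" where
  "floer_level R c x =
     (if x = \<zero>\<^bsub>floer_chains R c\<^esub> then - \<infinity>
      else ereal (GREATEST t. t \<in> action c ` {p \<in> points c. x p \<noteq> \<zero>\<^bsub>R\<^esub>}))"

definition filtered_chains ::
  "('r, 'm) ring_scheme \<Rightarrow> ('r, 'g, 's, 'p) floer_novikov \<Rightarrow> real \<Rightarrow> ('p \<Rightarrow> 'r) set" where
  "filtered_chains R c t = {x \<in> carrier (floer_chains R c). floer_level R c x \<le> ereal t}"

definition filtered_homology ::
  "('r, 'm) ring_scheme \<Rightarrow> ('r, 'g, 's, 'p) floer_novikov \<Rightarrow> real \<Rightarrow> ('p \<Rightarrow> 'r) set monoid" where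
  "filtered_homology R c t = subcomplex_homology R c (filtered_chains R c t)"

text \<open>
  A class in the filtered homology is a coset \<open>K\<close> of cycles; all its elements have the same class
  in the full homology, and the union over \<open>K\<close> is that class.
\<close>

definition inclusion_induced ::
  "('r, 'm) ring_scheme \<Rightarrow> ('r, 'g, 's, 'p) floer_novikov \<Rightarrow> ('p \<Rightarrow> 'r) set \<Rightarrow> ('p \<Rightarrow> 'r) set" where
  "inclusion_induced R c K = (\<Union>x\<in>K. floer_class R c x)"

text \<open>The infimum is taken in the extended reals: the zero class has spectral number \<open>-\<infinity>\<close>.\<close>

definition spectral_number ::
  "('r, 'm) ring_scheme \<Rightarrow> ('r, 'g, 's, 'p) floer_novikov \<Rightarrow> ('p \<Rightarrow> 'r) set \<Rightarrow> ereal" where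
  "spectral_number R c a =
     Inf {ereal t | t. a \<in> inclusion_induced R c ` carrier (filtered_homology R c t)}"

end

theory Submission
  imports Defs
begin

text \<open>
Let \<open>U\<close> be the submodule of boundaries of the chain complex \<open>C\<close>.  A class is a coset \<open>x + U\<close>, its
spectral number is the infimum of the levels on this coset, and the claim is that some element of
the coset has the least level.  The argument applies to every subgroup \<open>U\<close> that is closed under
multiplication by the Novikov ring.

Write the part of a chain at action exactly \<open>t\<close> as its slice at \<open>t\<close>.  A chain \<open>y\<close> of level at most
\<open>s\<close> is reducible if some \<open>u\<close> in \<open>U\<close> of level at most \<open>s\<close> has the same slice at \<open>s\<close> as \<open>y\<close>;
subtracting \<open>u\<close> then lowers the level below \<open>s\<close>.  If the coset contains an irreducible element, this
element has the least level: an element of smaller level would differ from it by an element of \<open>U\<close>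
with the forbidden leading slice.  So everything comes down to \<open>reducible_imp_mem\<close>: if every
element of the coset is reducible, then the coset is \<open>U\<close> itself, and zero, of level \<open>-\<infinity>\<close>, is the
best representative.

To see this one reduces again and again.  The danger is that the levels decrease but accumulate at
a finite value, because the periods may be dense in the reals.  This is where the Noetherian
hypothesis enters.  Slices are finite chains, and the finite chains are a finitely generated module
over the group ring of \<open>\<Gamma>\<close>, which is Noetherian by Hilbert's basis theorem.  Hence finitely many
slices of elements \<open>v\<^sub>1, \<dots>, v\<^sub>k\<close> of \<open>U\<close> generate all leading slices of elements of \<open>U\<close>
(\<open>finitely_many_leading_slices\<close>), and each reduction can be done with a combination of translates
of the \<open>v\<^sub>i\<close>.  By the finiteness condition on chains there is \<open>\<delta> > 0\<close> such that no \<open>v\<^sub>i\<close> has a term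
within \<open>\<delta>\<close> below its leading slice (\<open>leading_gap\<close>).  A reduction at level \<open>s\<close> therefore creates no
new term of action above \<open>s - \<delta>\<close>, so that finitely many reductions clear a window of width \<open>\<delta>\<close>.
Repeating this for successive windows sends the level to \<open>-\<infinity>\<close>.  The coefficients used in different
windows sit at different periods and add up to elements \<open>\<lambda>\<^sub>i\<close> of the Novikov ring, and
\<open>x = \<lambda>\<^sub>1 v\<^sub>1 + \<dots> + \<lambda>\<^sub>k v\<^sub>k\<close> lies in \<open>U\<close>.

Hilbert's basis theorem is proved for abelian groups with operators instead of modules over a
polynomial ring.  If \<open>Y\<close> is Noetherian for a set of operators and \<open>T\<close> commutes with these, then the
sum of all \<open>T\<^sup>n Y\<close> is Noetherian for the operators together with \<open>T\<close> (\<open>poly_noetherian\<close>).  Starting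
from the finite-rank module spanned by one point in each orbit and adjoining the translations by
group generators one at a time, this yields \<open>finite_chains_noetherian\<close>.  The sum of the \<open>T\<^sup>n Y\<close>
may be a proper quotient of the polynomials over \<open>Y\<close>, which accommodates the relations in \<open>\<Gamma>\<close>.
\<close>

section \<open>Noetherian abelian groups with operators\<close>

context abelian_group
begin

abbreviation endos :: "('a \<Rightarrow> 'a) set"
  where "endos \<equiv> hom (add_monoid G) (add_monoid G)"

text \<open>
The operators need not be closed under composition or addition, so the span is built up step by
step.  Closure under differences is the single rule that makes the span a subgroup.
\<close>

inductive_set op_span :: "('a \<Rightarrow> 'a) set \<Rightarrow> 'a set \<Rightarrow> 'a set"
  for E :: "('a \<Rightarrow> 'a) set" and F :: "'a set"
  where
    zero: "\<zero> \<in> op_span E F"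
  | gen: "x \<in> F \<Longrightarrow> x \<in> op_span E F"
  | diff: "x \<in> op_span E F \<Longrightarrow> y \<in> op_span E F \<Longrightarrow> x \<ominus> y \<in> op_span E F"
  | oper: "T \<in> E \<Longrightarrow> x \<in> op_span E F \<Longrightarrow> T x \<in> op_span E F"

definition op_subgroup :: "('a \<Rightarrow> 'a) set \<Rightarrow> 'a set \<Rightarrow> bool"
  where "op_subgroup E N \<longleftrightarrow> N \<subseteq> carrier G \<and> \<zero> \<in> N \<and>
    (\<forall>x\<in>N. \<forall>y\<in>N. x \<ominus> y \<in> N) \<and> (\<forall>T\<in>E. \<forall>x\<in>N. T x \<in> N)"

definition op_noetherian :: "('a \<Rightarrow> 'a) set \<Rightarrow> 'a set \<Rightarrow> bool"
  where "op_noetherian E V \<longleftrightarrow>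
    (\<forall>N. op_subgroup E N \<longrightarrow> N \<subseteq> V \<longrightarrow> (\<exists>F. finite F \<and> F \<subseteq> N \<and> N \<subseteq> op_span E F))"

lemma endos_closed: "T \<in> endos \<Longrightarrow> x \<in> carrier G \<Longrightarrow> T x \<in> carrier G"
  by (auto simp: hom_def)

lemma endos_add: "T \<in> endos \<Longrightarrow> x \<in> carrier G \<Longrightarrow> y \<in> carrier G \<Longrightarrow> T (x \<oplus> y) = T x \<oplus> T y"
  by (auto simp: hom_def)

lemma endos_zero: "T \<in> endos \<Longrightarrow> T \<zero> = \<zero>"
  using endos_add[of T \<zero> \<zero>] endos_closed[of T \<zero>] by (simp add: add.l_cancel_one)

lemma endos_minus:
  assumes "T \<in> endos" "x \<in> carrier G" "y \<in> carrier G"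
  shows "T (x \<ominus> y) = T x \<ominus> T y"
proof -
  have "T y \<oplus> T (\<ominus> y) = \<zero>"
    using assms endos_add[of T y "\<ominus> y"] endos_zero[OF assms(1)] by (simp add: r_neg)
  then have "T (\<ominus> y) = \<ominus> T y"
    using assms endos_closed by (metis a_inv_closed minus_equality a_comm)
  then show ?thesis
    using assms endos_add[of T x "\<ominus> y"] by (simp add: a_minus_def)
qed

lemma add_minus_add:
  assumes "x \<in> carrier G" "y \<in> carrier G" "x' \<in> carrier G" "y' \<in> carrier G"
  shows "(x \<oplus> y) \<ominus> (x' \<oplus> y') = (x \<ominus> x') \<oplus> (y \<ominus> y')"
  using assms by (simp add: a_minus_def minus_add a_ac)

lemma endos_funpow: "T \<in> endos \<Longrightarrow> T ^^ n \<in> endos"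
  by (induction n) (auto simp: hom_def Pi_iff)

lemma op_subgroupD:
  assumes "op_subgroup E N"
  shows "N \<subseteq> carrier G" "\<zero> \<in> N" "x \<in> N \<Longrightarrow> y \<in> N \<Longrightarrow> x \<ominus> y \<in> N"
    "T \<in> E \<Longrightarrow> x \<in> N \<Longrightarrow> T x \<in> N"
  using assms by (auto simp: op_subgroup_def)

lemma minus_minus_zero: "x \<in> carrier G \<Longrightarrow> y \<in> carrier G \<Longrightarrow> x \<ominus> (\<zero> \<ominus> y) = x \<oplus> y"
  by (simp add: a_minus_def)

lemma op_subgroup_add:
  assumes "op_subgroup E N" "x \<in> N" "y \<in> N"
  shows "x \<oplus> y \<in> N"
  using op_subgroupD[OF assms(1)] assms(2,3) minus_minus_zero[of x y] by (metis subsetD)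

lemma op_subgroup_funpow: "op_subgroup E N \<Longrightarrow> T \<in> E \<Longrightarrow> x \<in> N \<Longrightarrow> (T ^^ n) x \<in> N"
  by (induction n) (auto simp: op_subgroupD)

lemma op_subgroup_antimono: "op_subgroup E N \<Longrightarrow> E' \<subseteq> E \<Longrightarrow> op_subgroup E' N"
  by (auto simp: op_subgroup_def)

lemma op_subgroup_Int: "op_subgroup E N \<Longrightarrow> op_subgroup E N' \<Longrightarrow> op_subgroup E (N \<inter> N')"
  by (auto simp: op_subgroup_def)

lemma op_span_least: "op_subgroup E N \<Longrightarrow> F \<subseteq> N \<Longrightarrow> op_span E F \<subseteq> N"
proof
  fix x assume *: "op_subgroup E N" "F \<subseteq> N" "x \<in> op_span E F"
  show "x \<in> N" using *(3) by induction (use * in \<open>auto simp: op_subgroupD\<close>)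
qed

lemma op_span_mono: "E \<subseteq> E' \<Longrightarrow> F \<subseteq> F' \<Longrightarrow> op_span E F \<subseteq> op_span E' F'"
proof
  fix x assume *: "E \<subseteq> E'" "F \<subseteq> F'" "x \<in> op_span E F"
  show "x \<in> op_span E' F'" using *(3) by induction (use * in \<open>auto intro: op_span.intros\<close>)
qed

lemma op_subgroup_carrier: "E \<subseteq> endos \<Longrightarrow> op_subgroup E (carrier G)"
  using endos_closed by (auto simp: op_subgroup_def)

lemma op_subgroup_op_span:
  assumes "E \<subseteq> endos" "F \<subseteq> carrier G"
  shows "op_subgroup E (op_span E F)"
  using op_span_least[OF op_subgroup_carrier[OF assms(1)] assms(2)]
  by (auto simp: op_subgroup_def intro: op_span.intros)

lemma op_span_finitary: "x \<in> op_span E F \<Longrightarrow> \<exists>F'. finite F' \<and> F' \<subseteq> F \<and> x \<in> op_span E F'"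
proof (induction rule: op_span.induct)
  case zero
  show ?case by (rule exI[of _ "{}"]) (auto intro: op_span.zero)
next
  case (gen x)
  show ?case by (rule exI[of _ "{x}"]) (use gen in \<open>auto intro: op_span.gen\<close>)
next
  case (diff x y)
  then obtain F1 F2 where "finite F1" "F1 \<subseteq> F" "x \<in> op_span E F1" "finite F2" "F2 \<subseteq> F" "y \<in> op_span E F2"
    by auto
  then show ?case
    using op_span_mono[of E E F1 "F1 \<union> F2"] op_span_mono[of E E F2 "F1 \<union> F2"]
    by (intro exI[of _ "F1 \<union> F2"]) (auto intro!: op_span.diff)
next
  case (oper T x)
  then show ?case by (auto intro: op_span.oper)
qed

lemma op_noetherianD:
  "op_noetherian E V \<Longrightarrow> op_subgroup E N \<Longrightarrow> N \<subseteq> V \<Longrightarrow> \<exists>F. finite F \<and> F \<subseteq> N \<and> N \<subseteq> op_span E F"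
  by (simp add: op_noetherian_def)

text \<open>
Finite generation with generators chosen from a prescribed generating set: each of finitely many
generators of the span already lies in the span of finitely many elements of the set.
\<close>

lemma op_noetherian_subset_finite:
  assumes E: "E \<subseteq> endos" and V: "op_subgroup E V" "op_noetherian E V" and M: "M \<subseteq> V"
  shows "\<exists>F. finite F \<and> F \<subseteq> M \<and> M \<subseteq> op_span E F"
proof -
  have MG: "M \<subseteq> carrier G" using M V(1) op_subgroupD(1) by blast
  have "op_subgroup E (op_span E M)" by (rule op_subgroup_op_span[OF E MG])
  moreover have "op_span E M \<subseteq> V" by (rule op_span_least[OF V(1) M])
  ultimately obtain F where F: "finite F" "F \<subseteq> op_span E M" "op_span E M \<subseteq> op_span E F"
    using op_noetherianD[OF V(2)] by metis
  have "\<forall>f\<in>F. \<exists>S. finite S \<and> S \<subseteq> M \<and> f \<in> op_span E S"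
    using F(2) op_span_finitary by blast
  then obtain S where S: "\<And>f. f \<in> F \<Longrightarrow> finite (S f) \<and> S f \<subseteq> M \<and> f \<in> op_span E (S f)"
    by metis
  let ?S = "\<Union>f\<in>F. S f"
  have fin: "finite ?S" "?S \<subseteq> M" using F(1) S by auto
  have "F \<subseteq> op_span E ?S"
  proof
    fix f assume "f \<in> F"
    then have "f \<in> op_span E (S f)" "S f \<subseteq> ?S" using S by auto
    then show "f \<in> op_span E ?S" using op_span_mono[of E E "S f" ?S] by blast
  qed
  then have "op_span E F \<subseteq> op_span E ?S"
    using fin MG by (intro op_span_least op_subgroup_op_span[OF E]) auto
  then have "M \<subseteq> op_span E ?S" using F(3) by (auto intro: op_span.gen)
  with fin show ?thesis by blast
qed

text \<open>
For \<open>S = T\<^sup>n\<close> and \<open>Z\<close> the polynomials in \<open>T\<close> of degree below \<open>n\<close>, the set in question consists of the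
leading coefficients of the elements of \<open>N\<close> of degree at most \<open>n\<close>.  For \<open>S\<close> the identity it
consists of the elements of \<open>Y\<close> that are congruent modulo \<open>Z\<close> to an element of \<open>N\<close>.
\<close>

lemma op_subgroup_leading_parts:
  assumes E: "E \<subseteq> endos" and S: "S \<in> endos"
    and comm: "\<And>T x. T \<in> E \<Longrightarrow> x \<in> carrier G \<Longrightarrow> S (T x) = T (S x)"
    and Y: "op_subgroup E Y"
    and Z: "op_subgroup E Z" and N: "op_subgroup E N"
  shows "op_subgroup E {y \<in> Y. \<exists>z\<in>Z. S y \<oplus> z \<in> N}"
proof -
  define L where "L = {y \<in> Y. \<exists>z\<in>Z. S y \<oplus> z \<in> N}"
  have YG: "y \<in> carrier G" if "y \<in> Y" for y
    using op_subgroupD(1)[OF Y] that by blast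
  have ZG: "z \<in> carrier G" if "z \<in> Z" for z
    using op_subgroupD(1)[OF Z] that by blast
  have minus: "S (y \<ominus> y') \<oplus> (z \<ominus> z') = (S y \<oplus> z) \<ominus> (S y' \<oplus> z')"
    if "y \<in> carrier G" "y' \<in> carrier G" "z \<in> carrier G" "z' \<in> carrier G" for y y' z z'
    using that endos_closed[OF S] by (simp add: endos_minus[OF S] add_minus_add)
  have oper_lift: "S (T y) \<oplus> T z = T (S y \<oplus> z)"
    if "T \<in> E" "y \<in> carrier G" "z \<in> carrier G" for T y z
    using that S E endos_closed[OF S] by (subst endos_add) (auto simp: comm)
  have "op_subgroup E L"
    unfolding op_subgroup_def
  proof (intro conjI ballI)
    show "L \<subseteq> carrier G" using YG by (auto simp: L_def)
    have "S \<zero> \<oplus> \<zero> = \<zero>" using endos_zero[OF S] by simp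
    then show "\<zero> \<in> L"
      using op_subgroupD(2)[OF Y] op_subgroupD(2)[OF Z] op_subgroupD(2)[OF N] unfolding L_def by force
  next
    fix x y assume "x \<in> L" "y \<in> L"
    then obtain z z' where z: "x \<in> Y" "z \<in> Z" "S x \<oplus> z \<in> N" "y \<in> Y" "z' \<in> Z" "S y \<oplus> z' \<in> N"
      by (auto simp: L_def)
    then have "S (x \<ominus> y) \<oplus> (z \<ominus> z') \<in> N"
      using minus[OF YG[OF z(1)] YG[OF z(4)] ZG[OF z(2)] ZG[OF z(5)]] op_subgroupD(3)[OF N z(3) z(6)] by simp
    then show "x \<ominus> y \<in> L"
      using z op_subgroupD(3)[OF Z, of z z'] op_subgroupD(3)[OF Y, of x y]
      by (auto simp: L_def)
  next
    fix T x assume T: "T \<in> E" and "x \<in> L"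
    then obtain z where z: "x \<in> Y" "z \<in> Z" "S x \<oplus> z \<in> N" by (auto simp: L_def)
    then have "S (T x) \<oplus> T z \<in> N"
      using oper_lift[OF T YG[OF z(1)] ZG[OF z(2)]] op_subgroupD(4)[OF N T z(3)] by simp
    then show "T x \<in> L"
      using z op_subgroupD(4)[OF Z T] op_subgroupD(4)[OF Y T] by (auto simp: L_def)
  qed
  then show ?thesis unfolding L_def .
qed

text \<open>
Finitely many elements of \<open>N\<close> realise all leading parts: choose generators of the operator subgroup
of leading parts, lift them to \<open>N\<close>, and observe that each step in building a span carries the
lower-order remainder in \<open>Z\<close> along.
\<close>

lemma leading_part_finite:
  assumes E: "E \<subseteq> endos" and S: "S \<in> endos"
    and comm: "\<And>T x. T \<in> E \<Longrightarrow> x \<in> carrier G \<Longrightarrow> S (T x) = T (S x)"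
    and Y: "op_subgroup E Y" "op_noetherian E Y"
    and Z: "op_subgroup E Z" and N: "op_subgroup E N"
  shows "\<exists>F. finite F \<and> F \<subseteq> N \<and>
    (\<forall>y\<in>Y. \<forall>z\<in>Z. S y \<oplus> z \<in> N \<longrightarrow> (\<exists>z'\<in>Z. S y \<oplus> z' \<in> op_span E F))"
proof -
  define L where "L = {y \<in> Y. \<exists>z\<in>Z. S y \<oplus> z \<in> N}"
  have YG: "y \<in> carrier G" if "y \<in> Y" for y
    using op_subgroupD(1)[OF Y(1)] that by blast
  have ZG: "z \<in> carrier G" if "z \<in> Z" for z
    using op_subgroupD(1)[OF Z] that by blast
  have minus: "S (y \<ominus> y') \<oplus> (z \<ominus> z') = (S y \<oplus> z) \<ominus> (S y' \<oplus> z')"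
    if "y \<in> carrier G" "y' \<in> carrier G" "z \<in> carrier G" "z' \<in> carrier G" for y y' z z'
    using that endos_closed[OF S] by (simp add: endos_minus[OF S] add_minus_add)
  have oper_lift: "S (T y) \<oplus> T z = T (S y \<oplus> z)"
    if "T \<in> E" "y \<in> carrier G" "z \<in> carrier G" for T y z
    using that S E endos_closed[OF S] by (subst endos_add) (auto simp: comm)
  have "op_subgroup E L"
    unfolding L_def by (rule op_subgroup_leading_parts[OF E S comm Y(1) Z N])
  moreover have "L \<subseteq> Y" unfolding L_def by blast
  ultimately obtain F where F: "finite F" "F \<subseteq> L" "L \<subseteq> op_span E F"
    using op_noetherianD[OF Y(2)] by metis
  have "\<forall>f\<in>F. \<exists>z. z \<in> Z \<and> S f \<oplus> z \<in> N"
    using F(2) unfolding L_def by blast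
  then obtain z where z: "\<And>f. f \<in> F \<Longrightarrow> z f \<in> Z \<and> S f \<oplus> z f \<in> N"
    by metis
  let ?F = "(\<lambda>f. S f \<oplus> z f) ` F"
  have *: "y \<in> carrier G \<and> (\<exists>z'\<in>Z. S y \<oplus> z' \<in> op_span E ?F)" if "y \<in> op_span E F" for y
    using that
  proof (induction rule: op_span.induct)
    case zero
    have "S \<zero> \<oplus> \<zero> = \<zero>" using endos_zero[OF S] by simp
    then have "S \<zero> \<oplus> \<zero> \<in> op_span E ?F" using op_span.zero by simp
    then show ?case using op_subgroupD(2)[OF Z] by blast
  next
    case (gen x)
    then show ?case using z F(2) YG by (auto simp: L_def intro: op_span.gen)
  next
    case (diff x y)
    then obtain z1 z2 where w: "x \<in> carrier G" "y \<in> carrier G" "z1 \<in> Z" "z2 \<in> Z"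
      "S x \<oplus> z1 \<in> op_span E ?F" "S y \<oplus> z2 \<in> op_span E ?F" by auto
    then have "S (x \<ominus> y) \<oplus> (z1 \<ominus> z2) \<in> op_span E ?F"
      using minus[OF w(1,2) ZG[OF w(3)] ZG[OF w(4)]] op_span.diff[OF w(5,6)] by simp
    then show ?case using w op_subgroupD(3)[OF Z] by auto
  next
    case (oper T x)
    then obtain z1 where w: "x \<in> carrier G" "z1 \<in> Z" "S x \<oplus> z1 \<in> op_span E ?F" by auto
    then have "S (T x) \<oplus> T z1 \<in> op_span E ?F"
      using oper_lift[OF oper(1) w(1) ZG[OF w(2)]] op_span.oper[OF oper(1) w(3)] by simp
    then show ?case using w op_subgroupD(4)[OF Z oper(1)] E oper(1) endos_closed by blast
  qed
  show ?thesis
  proof (intro exI[of _ ?F] conjI ballI impI)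
    show "finite ?F" "?F \<subseteq> N" using F(1) z by auto
    fix y z' assume "y \<in> Y" "z' \<in> Z" "S y \<oplus> z' \<in> N"
    then have "y \<in> L" by (auto simp: L_def)
    then show "\<exists>z'\<in>Z. S y \<oplus> z' \<in> op_span E ?F" using F(3) * by blast
  qed
qed

lemma op_subgroup_sum:
  assumes E: "E \<subseteq> endos" and S: "S \<in> endos"
    and comm: "\<And>T x. T \<in> E \<Longrightarrow> x \<in> carrier G \<Longrightarrow> S (T x) = T (S x)"
    and Y: "op_subgroup E Y" and Z: "op_subgroup E Z"
  shows "op_subgroup E {S y \<oplus> z | y z. y \<in> Y \<and> z \<in> Z}"
  unfolding op_subgroup_def
proof (intro conjI ballI)
  note YG = op_subgroupD(1)[OF Y, THEN subsetD] and ZG = op_subgroupD(1)[OF Z, THEN subsetD]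
  show "{S y \<oplus> z | y z. y \<in> Y \<and> z \<in> Z} \<subseteq> carrier G"
    using YG ZG endos_closed[OF S] by auto
  have "\<zero> = S \<zero> \<oplus> \<zero>" using endos_zero[OF S] by simp
  then show "\<zero> \<in> {S y \<oplus> z | y z. y \<in> Y \<and> z \<in> Z}"
    using op_subgroupD(2)[OF Y] op_subgroupD(2)[OF Z] by blast
next
  note YG = op_subgroupD(1)[OF Y, THEN subsetD] and ZG = op_subgroupD(1)[OF Z, THEN subsetD]
  fix a b assume "a \<in> {S y \<oplus> z | y z. y \<in> Y \<and> z \<in> Z}" "b \<in> {S y \<oplus> z | y z. y \<in> Y \<and> z \<in> Z}"
  then obtain y z y' z' where w: "a = S y \<oplus> z" "y \<in> Y" "z \<in> Z" "b = S y' \<oplus> z'" "y' \<in> Y" "z' \<in> Z"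
    by auto
  have "a \<ominus> b = S (y \<ominus> y') \<oplus> (z \<ominus> z')"
    unfolding w using w YG ZG endos_closed[OF S] by (simp add: endos_minus[OF S] add_minus_add)
  then show "a \<ominus> b \<in> {S y \<oplus> z | y z. y \<in> Y \<and> z \<in> Z}"
    using op_subgroupD(3)[OF Y w(2,5)] op_subgroupD(3)[OF Z w(3,6)] by blast
next
  note YG = op_subgroupD(1)[OF Y, THEN subsetD] and ZG = op_subgroupD(1)[OF Z, THEN subsetD]
  fix T a assume T: "T \<in> E" and "a \<in> {S y \<oplus> z | y z. y \<in> Y \<and> z \<in> Z}"
  then obtain y z where w: "a = S y \<oplus> z" "y \<in> Y" "z \<in> Z" by auto
  have "T a = S (T y) \<oplus> T z"
    unfolding w using w YG ZG S E T endos_closed[OF S] by (subst endos_add) (auto simp: comm)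
  then show "T a \<in> {S y \<oplus> z | y z. y \<in> Y \<and> z \<in> Z}"
    using op_subgroupD(4)[OF Y T w(2)] op_subgroupD(4)[OF Z T w(3)] by blast
qed

lemma minus_cancel_left:
  "x \<in> carrier G \<Longrightarrow> y \<in> carrier G \<Longrightarrow> z \<in> carrier G \<Longrightarrow> (x \<oplus> y) \<ominus> (x \<oplus> z) = y \<ominus> z"
  by (simp add: add_minus_add) (simp add: a_minus_def r_neg)

lemma minus_add_cancel: "x \<in> carrier G \<Longrightarrow> y \<in> carrier G \<Longrightarrow> (x \<ominus> y) \<oplus> y = x"
  by (simp add: a_minus_def a_assoc l_neg)

text \<open>
As for extensions of Noetherian modules: lifts of generators of the projection of \<open>N\<close> to \<open>Y\<close>,
together with generators of \<open>N \<inter> Z\<close>, generate \<open>N\<close>.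
\<close>

lemma op_noetherian_sum:
  assumes E: "E \<subseteq> endos"
    and Y: "op_subgroup E Y" "op_noetherian E Y" and Z: "op_subgroup E Z" "op_noetherian E Z"
  shows "op_noetherian E {y \<oplus> z | y z. y \<in> Y \<and> z \<in> Z}"
  unfolding op_noetherian_def
proof (intro allI impI)
  fix N assume N: "op_subgroup E N" and sub: "N \<subseteq> {y \<oplus> z | y z. y \<in> Y \<and> z \<in> Z}"
  have id: "(\<lambda>x. x) \<in> endos" by (auto simp: hom_def)
  obtain F1 where F1: "finite F1" "F1 \<subseteq> N"
    "\<And>y z. y \<in> Y \<Longrightarrow> z \<in> Z \<Longrightarrow> y \<oplus> z \<in> N \<Longrightarrow> \<exists>z'\<in>Z. y \<oplus> z' \<in> op_span E F1"
    using leading_part_finite[OF E id _ Y Z(1) N] by blast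
  obtain F2 where F2: "finite F2" "F2 \<subseteq> N \<inter> Z" "N \<inter> Z \<subseteq> op_span E F2"
    using op_noetherianD[OF Z(2) op_subgroup_Int[OF N Z(1)]] by blast
  have F12: "F1 \<union> F2 \<subseteq> N" using F1 F2 by auto
  have span: "op_subgroup E (op_span E (F1 \<union> F2))"
    using F12 op_subgroupD(1)[OF N] by (intro op_subgroup_op_span[OF E]) auto
  have "N \<subseteq> op_span E (F1 \<union> F2)"
  proof
    fix x assume x: "x \<in> N"
    then obtain y z where yz: "y \<in> Y" "z \<in> Z" "x = y \<oplus> z" using sub by auto
    then obtain z' where z': "z' \<in> Z" "y \<oplus> z' \<in> op_span E F1" using F1(3) x by blast
    have c: "y \<in> carrier G" "z \<in> carrier G" "z' \<in> carrier G"
      using yz z' Y Z op_subgroupD(1) by blast+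
    have "y \<oplus> z' \<in> N" using z'(2) op_span_least[OF N F1(2)] by blast
    then have "x \<ominus> (y \<oplus> z') \<in> N" using x op_subgroupD(3)[OF N] by blast
    moreover have "x \<ominus> (y \<oplus> z') = z \<ominus> z'" using yz c minus_cancel_left by simp
    ultimately have "x \<ominus> (y \<oplus> z') \<in> op_span E F2"
      using F2(3) op_subgroupD(3)[OF Z(1) yz(2) z'(1)] by auto
    then have "x \<ominus> (y \<oplus> z') \<in> op_span E (F1 \<union> F2)" "y \<oplus> z' \<in> op_span E (F1 \<union> F2)"
      using z'(2) op_span_mono[of E E F1 "F1 \<union> F2"] op_span_mono[of E E F2 "F1 \<union> F2"] by auto
    then have "(x \<ominus> (y \<oplus> z')) \<oplus> (y \<oplus> z') \<in> op_span E (F1 \<union> F2)"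
      using op_subgroup_add[OF span] by blast
    then show "x \<in> op_span E (F1 \<union> F2)" using c yz minus_add_cancel by auto
  qed
  then show "\<exists>F. finite F \<and> F \<subseteq> N \<and> N \<subseteq> op_span E F" using F1(1) F2(1) F12 by blast
qed

text \<open>
The polynomials of degree less than \<open>n\<close> in \<open>T\<close> with coefficients in \<open>Y\<close>, evaluated in the group.
An element can have several such representations, so leading coefficients are not unique.
\<close>

primrec poly_below :: "('a \<Rightarrow> 'a) \<Rightarrow> 'a set \<Rightarrow> nat \<Rightarrow> 'a set"
  where
    "poly_below T Y 0 = {\<zero>}"
  | "poly_below T Y (Suc n) = {(T ^^ n) y \<oplus> z | y z. y \<in> Y \<and> z \<in> poly_below T Y n}"

context
  fixes E T Y
  assumes E: "E \<subseteq> endos" and T: "T \<in> endos"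
    and comm: "\<And>S x. S \<in> E \<Longrightarrow> x \<in> carrier G \<Longrightarrow> T (S x) = S (T x)"
    and Y: "op_subgroup E Y"
begin

lemma funpow_comm: "S \<in> E \<Longrightarrow> x \<in> carrier G \<Longrightarrow> (T ^^ n) (S x) = S ((T ^^ n) x)"
  using endos_closed[OF endos_funpow[OF T]] comm by (induction n) auto

lemma poly_below_subgroup: "op_subgroup E (poly_below T Y n)"
proof (induction n)
  case 0
  have "\<forall>S\<in>E. S \<zero> = \<zero>" using E endos_zero by auto
  then show ?case by (auto simp: op_subgroup_def a_minus_def)
next
  case (Suc n)
  show ?case using op_subgroup_sum[OF E endos_funpow[OF T] funpow_comm Y Suc] by simp
qed

lemma poly_belowI: "y \<in> Y \<Longrightarrow> z \<in> poly_below T Y n \<Longrightarrow> (T ^^ n) y \<oplus> z \<in> poly_below T Y (Suc n)"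
  by auto

lemma poly_below_Suc: "poly_below T Y n \<subseteq> poly_below T Y (Suc n)"
proof
  fix z assume z: "z \<in> poly_below T Y n"
  have "(T ^^ n) \<zero> \<oplus> z = z"
    using z op_subgroupD(1)[OF poly_below_subgroup, of n] endos_zero[OF endos_funpow[OF T], of n]
    by (auto simp: subset_iff)
  then show "z \<in> poly_below T Y (Suc n)" using poly_belowI[OF op_subgroupD(2)[OF Y] z] by simp
qed

lemma poly_below_mono: "m \<le> n \<Longrightarrow> poly_below T Y m \<subseteq> poly_below T Y n"
  using lift_Suc_mono_le[of "poly_below T Y", OF poly_below_Suc] .

lemma poly_below_shift: "z \<in> poly_below T Y n \<Longrightarrow> T z \<in> poly_below T Y (Suc n)"
proof (induction n arbitrary: z)
  case 0
  then show ?case using endos_zero[OF T] poly_below_Suc[of 0] by auto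
next
  case (Suc n)
  then obtain y z' where w: "z = (T ^^ n) y \<oplus> z'" "y \<in> Y" "z' \<in> poly_below T Y n" by auto
  have "T z = (T ^^ Suc n) y \<oplus> T z'"
    using w op_subgroupD(1)[OF poly_below_subgroup] op_subgroupD(1)[OF Y]
      endos_closed[OF endos_funpow[OF T]] endos_add[OF T] by (auto simp: subset_iff)
  then show ?case using w Suc.IH[OF w(3)] by (simp only: poly_below.simps(2)[of _ _ "Suc n"]) blast
qed

lemma poly_below_funpow: "z \<in> poly_below T Y n \<Longrightarrow> (T ^^ k) z \<in> poly_below T Y (k + n)"
  by (induction k) (use poly_below_shift in auto)

lemma poly_subgroup: "op_subgroup (insert T E) (\<Union>n. poly_below T Y n)"
  unfolding op_subgroup_def
proof (intro conjI ballI)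
  show "(\<Union>n. poly_below T Y n) \<subseteq> carrier G" "\<zero> \<in> (\<Union>n. poly_below T Y n)"
    using op_subgroupD[OF poly_below_subgroup] by blast+
next
  fix x y assume "x \<in> (\<Union>n. poly_below T Y n)" "y \<in> (\<Union>n. poly_below T Y n)"
  then obtain m n where "x \<in> poly_below T Y m" "y \<in> poly_below T Y n" by auto
  then have "x \<in> poly_below T Y (max m n)" "y \<in> poly_below T Y (max m n)"
    using poly_below_mono[of m "max m n"] poly_below_mono[of n "max m n"] by auto
  then show "x \<ominus> y \<in> (\<Union>n. poly_below T Y n)" using op_subgroupD(3)[OF poly_below_subgroup] by blast
next
  fix S x assume "S \<in> insert T E" "x \<in> (\<Union>n. poly_below T Y n)"
  then show "S x \<in> (\<Union>n. poly_below T Y n)"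
    using op_subgroupD(4)[OF poly_below_subgroup] poly_below_shift by blast
qed

lemma poly_superset: "Y \<subseteq> (\<Union>n. poly_below T Y n)"
proof
  fix y assume "y \<in> Y"
  then have "(T ^^ 0) y \<oplus> \<zero> = y" using op_subgroupD(1)[OF Y] by auto
  then have "y \<in> poly_below T Y (Suc 0)" using poly_belowI[OF \<open>y \<in> Y\<close>, of \<zero> 0] by simp
  then show "y \<in> (\<Union>n. poly_below T Y n)" by blast
qed

text \<open>
Hilbert's argument.  The leading coefficients \<open>L n\<close> of degree \<open>n\<close> of elements of \<open>N\<close> increase with \<open>n\<close>,
since \<open>T\<close> maps \<open>N\<close> to itself, and become stationary at some \<open>d\<close>.  Finitely many elements of \<open>N\<close>
realise the leading coefficients of degrees up to \<open>d\<close>.  Shifted by powers of \<open>T\<close> they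
cancel the leading term of any element of \<open>N\<close>, and induction on the degree finishes the proof.
\<close>

theorem poly_noetherian:
  assumes noeth: "op_noetherian E Y"
  shows "op_noetherian (insert T E) (\<Union>n. poly_below T Y n)"
  unfolding op_noetherian_def
proof (intro allI impI)
  fix N assume N': "op_subgroup (insert T E) N" and sub: "N \<subseteq> (\<Union>n. poly_below T Y n)"
  note N = op_subgroup_antimono[OF N' subset_insertI]
  have NT: "T x \<in> N" if "x \<in> N" for x using op_subgroupD(4)[OF N'] that by blast
  have YG: "y \<in> carrier G" if "y \<in> Y" for y using op_subgroupD(1)[OF Y] that by blast
  have XG: "z \<in> carrier G" if "z \<in> poly_below T Y n" for n z
    using op_subgroupD(1)[OF poly_below_subgroup] that by blast
  have E': "insert T E \<subseteq> endos" using E T by auto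
  define L where "L n = {y \<in> Y. \<exists>z\<in>poly_below T Y n. (T ^^ n) y \<oplus> z \<in> N}" for n
  have L_Suc: "L n \<subseteq> L (Suc n)" for n
  proof
    fix y assume "y \<in> L n"
    then obtain z where z: "y \<in> Y" "z \<in> poly_below T Y n" "(T ^^ n) y \<oplus> z \<in> N" by (auto simp: L_def)
    have "(T ^^ Suc n) y \<oplus> T z \<in> N"
      using NT[OF z(3)] endos_add[OF T endos_closed[OF endos_funpow[OF T] YG[OF z(1)]] XG[OF z(2)]]
      by simp
    then show "y \<in> L (Suc n)" using z poly_below_shift[OF z(2)] by (auto simp: L_def)
  qed
  have L_mono: "L m \<subseteq> L n" if "m \<le> n" for m n
    using lift_Suc_mono_le[of L, OF L_Suc that] .
  obtain F where F: "finite F" "F \<subseteq> (\<Union>n. L n)" "(\<Union>n. L n) \<subseteq> op_span E F"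
  proof -
    have "(\<Union>n. L n) \<subseteq> Y" by (auto simp: L_def)
    from op_noetherian_subset_finite[OF E Y noeth this] that show ?thesis by metis
  qed
  obtain k where k: "\<And>f. f \<in> F \<Longrightarrow> f \<in> L (k f)" using F(2) by (metis UN_E subsetD)
  define d where "d = Max (insert 0 (k ` F))"
  have Fd: "F \<subseteq> L d"
  proof
    fix f assume "f \<in> F"
    then have "k f \<le> d" unfolding d_def using F(1) by (intro Max_ge) auto
    then show "f \<in> L d" using k[OF \<open>f \<in> F\<close>] L_mono by blast
  qed
  have Ld: "op_subgroup E (L d)"
    unfolding L_def
    by (rule op_subgroup_leading_parts[OF E endos_funpow[OF T] funpow_comm Y poly_below_subgroup N])
  have stable: "L n \<subseteq> L (min n d)" for n
    using op_span_least[OF Ld Fd] F(3) by (cases "n \<le> d") (auto simp: min_def)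
  have "\<forall>i. \<exists>F. finite F \<and> F \<subseteq> N \<and> (\<forall>y\<in>Y. \<forall>z\<in>poly_below T Y i. (T ^^ i) y \<oplus> z \<in> N \<longrightarrow>
      (\<exists>z'\<in>poly_below T Y i. (T ^^ i) y \<oplus> z' \<in> op_span E F))"
    using leading_part_finite[OF E endos_funpow[OF T] funpow_comm Y noeth poly_below_subgroup N] by blast
  then obtain H where H: "\<And>i. finite (H i)" "\<And>i. H i \<subseteq> N"
    "\<And>i y z. y \<in> Y \<Longrightarrow> z \<in> poly_below T Y i \<Longrightarrow> (T ^^ i) y \<oplus> z \<in> N \<Longrightarrow>
      \<exists>z'\<in>poly_below T Y i. (T ^^ i) y \<oplus> z' \<in> op_span E (H i)"
    by metis
  define K where "K = (\<Union>i\<le>d. H i)"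
  have K: "finite K" "K \<subseteq> N" unfolding K_def using H by auto
  define W where "W = op_span (insert T E) K"
  have W: "op_subgroup (insert T E) W"
    unfolding W_def using K op_subgroupD(1)[OF N] by (intro op_subgroup_op_span[OF E']) auto
  have WN: "W \<subseteq> N" unfolding W_def using op_span_least[OF N' K(2)] .
  have "N \<inter> poly_below T Y n \<subseteq> W" for n
  proof (induction n)
    case 0
    then show ?case using op_subgroupD(2)[OF W] by auto
  next
    case (Suc n)
    show ?case
    proof
      fix x assume "x \<in> N \<inter> poly_below T Y (Suc n)"
      then obtain y z where x: "x \<in> N" "x = (T ^^ n) y \<oplus> z" and y: "y \<in> Y" and z: "z \<in> poly_below T Y n"
        by auto
      define i where "i = min n d"
      have "y \<in> L n" using x y z by (auto simp: L_def)
      then have "y \<in> L i" using stable i_def by blast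
      then obtain z' where z': "z' \<in> poly_below T Y i" "(T ^^ i) y \<oplus> z' \<in> op_span E (H i)"
        using H(3)[of y _ i] unfolding L_def by blast
      have "i \<le> d" "i \<le> n" by (auto simp: i_def)
      then have "(T ^^ i) y \<oplus> z' \<in> W"
        using z'(2) op_span_mono[of E "insert T E" "H i" K] unfolding W_def K_def by blast
      then have w: "(T ^^ (n - i)) ((T ^^ i) y \<oplus> z') \<in> W"
        using op_subgroup_funpow[OF W] by blast
      have "(T ^^ (n - i)) ((T ^^ i) y) = (T ^^ n) y"
        using \<open>i \<le> n\<close> by (metis add.commute comp_apply funpow_add le_add_diff_inverse)
      then have eq: "(T ^^ (n - i)) ((T ^^ i) y \<oplus> z') = (T ^^ n) y \<oplus> (T ^^ (n - i)) z'"
        using endos_add[OF endos_funpow[OF T] endos_closed[OF endos_funpow[OF T] YG[OF y]] XG[OF z'(1)]] by simp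
      have z'': "(T ^^ (n - i)) z' \<in> poly_below T Y n"
        using poly_below_funpow[OF z'(1), of "n - i"] \<open>i \<le> n\<close> by simp
      have "x \<ominus> (T ^^ (n - i)) ((T ^^ i) y \<oplus> z') = z \<ominus> (T ^^ (n - i)) z'"
        unfolding eq x(2)
        using minus_cancel_left[OF endos_closed[OF endos_funpow[OF T] YG[OF y]] XG[OF z] XG[OF z'']] .
      moreover have "x \<ominus> (T ^^ (n - i)) ((T ^^ i) y \<oplus> z') \<in> N"
        using op_subgroupD(3)[OF N x(1)] w WN by blast
      ultimately have "x \<ominus> (T ^^ (n - i)) ((T ^^ i) y \<oplus> z') \<in> W"
        using Suc op_subgroupD(3)[OF poly_below_subgroup z z''] by auto
      from op_subgroup_add[OF W this w] show "x \<in> W"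
        using minus_add_cancel[of x] x(1) w op_subgroupD(1)[OF N] op_subgroupD(1)[OF W]
        by (metis subsetD)
    qed
  qed
  then have "N \<subseteq> W" using sub by blast
  then show "\<exists>F. finite F \<and> F \<subseteq> N \<and> N \<subseteq> op_span (insert T E) F" using K unfolding W_def by blast
qed

end

end

section \<open>The chain complex and its filtration\<close>

locale floer_complex = cring R + noetherian_ring R
  for R :: "('r, 'm) ring_scheme" (structure) +
  fixes c :: "('r, 'g, 's, 'p) floer_novikov"
  assumes complex: "filtered_floer_novikov_complex R c"
begin

abbreviation "Gam \<equiv> gam c"
abbreviation "Pts \<equiv> points c"
abbreviation "Ch \<equiv> floer_chains R c"
abbreviation "Nov \<equiv> novikov_ring R (gam c) (period c)"

lemma complexD:
  shows "\<exists>A. finite A \<and> A \<subseteq> carrier Gam \<and> generate Gam A = carrier Gam"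
    "finite (base c)" "bproj c ` Pts = base c"
    "\<forall>p\<in>Pts. \<forall>q\<in>Pts. bproj c p = bproj c q \<longleftrightarrow> q \<in> orbit Gam (act c) p"
    "\<forall>g\<in>carrier Gam. \<forall>p\<in>Pts. act c g p = p \<longrightarrow> g = \<one>\<^bsub>Gam\<^esub>"
    "\<exists>D. is_floer_boundary R c D"
  using complex unfolding filtered_floer_novikov_complex_def principal_bundle_def by - (elim conjE, assumption)+

sublocale Gam: comm_group "gam c"
  using complex by (simp add: filtered_floer_novikov_complex_def)

sublocale act: group_action "gam c" "points c" "act c"
  using complex by (simp add: filtered_floer_novikov_complex_def principal_bundle_def)

text \<open>
Translation by \<open>g\<close> moves the coefficient at \<open>pull g q\<close> to \<open>q\<close>.  All formulas for the module
structure on chains involve this inverse action.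
\<close>

definition pull :: "'g \<Rightarrow> 'p \<Rightarrow> 'p"
  where "pull g q = act c (inv\<^bsub>Gam\<^esub> g) q"

lemma act_closed: "g \<in> carrier Gam \<Longrightarrow> p \<in> Pts \<Longrightarrow> act c g p \<in> Pts"
  using act.element_image by blast

lemma pull_closed: "g \<in> carrier Gam \<Longrightarrow> q \<in> Pts \<Longrightarrow> pull g q \<in> Pts"
  by (simp add: pull_def act_closed)

lemma act_one: "p \<in> Pts \<Longrightarrow> act c \<one>\<^bsub>Gam\<^esub> p = p"
  using act.id_eq_one by (metis restrict_apply')

lemma pull_one: "p \<in> Pts \<Longrightarrow> pull \<one>\<^bsub>Gam\<^esub> p = p"
  by (simp add: pull_def act_one)

lemma act_pull: "g \<in> carrier Gam \<Longrightarrow> q \<in> Pts \<Longrightarrow> act c g (pull g q) = q"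
  by (metis Gam.inv_closed Gam.r_inv act.composition_rule act_one pull_def)

lemma pull_act: "g \<in> carrier Gam \<Longrightarrow> p \<in> Pts \<Longrightarrow> pull g (act c g p) = p"
  by (metis Gam.inv_closed Gam.l_inv act.composition_rule act_one pull_def)

lemma pull_mult:
  "g \<in> carrier Gam \<Longrightarrow> h \<in> carrier Gam \<Longrightarrow> q \<in> Pts \<Longrightarrow> pull (g \<otimes>\<^bsub>Gam\<^esub> h) q = pull h (pull g q)"
  by (simp add: pull_def Gam.inv_mult_group act.composition_rule)

lemma pull_inj: "g \<in> carrier Gam \<Longrightarrow> h \<in> carrier Gam \<Longrightarrow> q \<in> Pts \<Longrightarrow> pull g q = pull h q \<Longrightarrow> g = h"
proof -
  assume *: "g \<in> carrier Gam" "h \<in> carrier Gam" "q \<in> Pts" "pull g q = pull h q"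
  have "act c (h \<otimes>\<^bsub>Gam\<^esub> inv\<^bsub>Gam\<^esub> g) q = q"
    using * act_pull[of h q] act.composition_rule[of q h "inv\<^bsub>Gam\<^esub> g"] by (simp add: pull_def)
  then have "h \<otimes>\<^bsub>Gam\<^esub> inv\<^bsub>Gam\<^esub> g = \<one>\<^bsub>Gam\<^esub>"
    using * complexD(5)[rule_format, of "h \<otimes>\<^bsub>Gam\<^esub> inv\<^bsub>Gam\<^esub> g" q] by blast
  then show "g = h" using * by (metis Gam.inv_equality Gam.inv_inv Gam.inv_closed)
qed

lemma period_mult:
  "g \<in> carrier Gam \<Longrightarrow> h \<in> carrier Gam \<Longrightarrow> period c (g \<otimes>\<^bsub>Gam\<^esub> h) = period c g + period c h"
  using complex by (simp add: filtered_floer_novikov_complex_def)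

lemma period_inv: "g \<in> carrier Gam \<Longrightarrow> period c (inv\<^bsub>Gam\<^esub> g) = - period c g"
  using period_mult[of g "inv\<^bsub>Gam\<^esub> g"] period_mult[of "\<one>\<^bsub>Gam\<^esub>" "\<one>\<^bsub>Gam\<^esub>"] by simp

lemma action_act: "g \<in> carrier Gam \<Longrightarrow> p \<in> Pts \<Longrightarrow> action c (act c g p) = action c p - period c g"
  using complex by (simp add: filtered_floer_novikov_complex_def)

lemma action_pull: "g \<in> carrier Gam \<Longrightarrow> q \<in> Pts \<Longrightarrow> action c (pull g q) = action c q + period c g"
  by (simp add: pull_def action_act period_inv)

lemma chain_iff:
  "x \<in> carrier Ch \<longleftrightarrow> x \<in> Pts \<rightarrow>\<^sub>E carrier R \<and> (\<forall>C. finite {q \<in> Pts. x q \<noteq> \<zero> \<and> action c q > C})"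
  by (simp add: floer_chains_def)

lemma chain_coeff: "x \<in> carrier Ch \<Longrightarrow> q \<in> Pts \<Longrightarrow> x q \<in> carrier R"
  by (auto simp: chain_iff)

lemma chain_finite: "x \<in> carrier Ch \<Longrightarrow> finite {q \<in> Pts. x q \<noteq> \<zero> \<and> action c q > C}"
  by (simp add: chain_iff)

lemma chain_eqI:
  assumes "x \<in> carrier Ch" "y \<in> carrier Ch" "\<And>q. q \<in> Pts \<Longrightarrow> x q = y q"
  shows "x = y"
  using assms by (auto simp: chain_iff intro: PiE_ext)

lemma chain_mono_support:
  assumes "x \<in> carrier Ch" "y \<in> Pts \<rightarrow>\<^sub>E carrier R" "\<And>q. q \<in> Pts \<Longrightarrow> x q = \<zero> \<Longrightarrow> y q = \<zero>"
  shows "y \<in> carrier Ch"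
  unfolding chain_iff
proof (intro conjI allI)
  fix C show "finite {q \<in> Pts. y q \<noteq> \<zero> \<and> action c q > C}"
    by (rule finite_subset[OF _ chain_finite[OF assms(1), of C]]) (use assms(3) in auto)
qed (rule assms(2))

lemma Ch_zero: "\<zero>\<^bsub>Ch\<^esub> = (\<lambda>q\<in>Pts. \<zero>)"
  by (simp add: floer_chains_def)

lemma Ch_add: "x \<oplus>\<^bsub>Ch\<^esub> y = (\<lambda>q\<in>Pts. x q \<oplus> y q)"
  by (simp add: floer_chains_def)

lemma Ch_zero_apply: "q \<in> Pts \<Longrightarrow> \<zero>\<^bsub>Ch\<^esub> q = \<zero>"
  by (simp add: Ch_zero)

lemma Ch_add_apply: "q \<in> Pts \<Longrightarrow> (x \<oplus>\<^bsub>Ch\<^esub> y) q = x q \<oplus> y q"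
  by (simp add: Ch_add)

lemma Ch_zero_closed: "\<zero>\<^bsub>Ch\<^esub> \<in> carrier Ch"
  by (simp add: chain_iff Ch_zero_apply cong: conj_cong) (simp add: Ch_zero)

lemma Ch_add_closed: "x \<in> carrier Ch \<Longrightarrow> y \<in> carrier Ch \<Longrightarrow> x \<oplus>\<^bsub>Ch\<^esub> y \<in> carrier Ch"
  unfolding chain_iff[of "x \<oplus>\<^bsub>Ch\<^esub> y"]
proof (intro conjI allI)
  assume x: "x \<in> carrier Ch" and y: "y \<in> carrier Ch"
  show "x \<oplus>\<^bsub>Ch\<^esub> y \<in> Pts \<rightarrow>\<^sub>E carrier R"
    using chain_coeff[OF x] chain_coeff[OF y] by (simp add: Ch_add)
  fix C
  have "{q \<in> Pts. (x \<oplus>\<^bsub>Ch\<^esub> y) q \<noteq> \<zero> \<and> action c q > C}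
    \<subseteq> {q \<in> Pts. x q \<noteq> \<zero> \<and> action c q > C} \<union> {q \<in> Pts. y q \<noteq> \<zero> \<and> action c q > C}"
    by (auto simp: Ch_add_apply)
  then show "finite {q \<in> Pts. (x \<oplus>\<^bsub>Ch\<^esub> y) q \<noteq> \<zero> \<and> action c q > C}"
    using finite_subset chain_finite[OF x] chain_finite[OF y] by (meson finite_UnI)
qed

lemma pointwise_closed:
  assumes x: "x \<in> carrier Ch"
    and f: "\<And>q a. q \<in> Pts \<Longrightarrow> a \<in> carrier R \<Longrightarrow> f q a \<in> carrier R" "\<And>q. q \<in> Pts \<Longrightarrow> f q \<zero> = \<zero>"
  shows "(\<lambda>q\<in>Pts. f q (x q)) \<in> carrier Ch"
  by (rule chain_mono_support[OF x]) (use f chain_coeff[OF x] in auto)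

sublocale Ch: abelian_group "floer_chains R c"
proof (rule abelian_groupI)
  show "x \<oplus>\<^bsub>Ch\<^esub> y \<in> carrier Ch" if "x \<in> carrier Ch" "y \<in> carrier Ch" for x y
    using that by (rule Ch_add_closed)
  show "\<zero>\<^bsub>Ch\<^esub> \<in> carrier Ch" by (rule Ch_zero_closed)
  show "x \<oplus>\<^bsub>Ch\<^esub> y \<oplus>\<^bsub>Ch\<^esub> z = x \<oplus>\<^bsub>Ch\<^esub> (y \<oplus>\<^bsub>Ch\<^esub> z)"
    if "x \<in> carrier Ch" "y \<in> carrier Ch" "z \<in> carrier Ch" for x y z
    by (rule chain_eqI) (use that chain_coeff in \<open>auto simp: Ch_add_closed Ch_add_apply a_assoc\<close>)
  show "x \<oplus>\<^bsub>Ch\<^esub> y = y \<oplus>\<^bsub>Ch\<^esub> x" if "x \<in> carrier Ch" "y \<in> carrier Ch" for x y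
    by (rule chain_eqI) (use that chain_coeff in \<open>auto simp: Ch_add_closed Ch_add_apply a_comm\<close>)
  show "\<zero>\<^bsub>Ch\<^esub> \<oplus>\<^bsub>Ch\<^esub> x = x" if "x \<in> carrier Ch" for x
    by (rule chain_eqI) (use that chain_coeff in \<open>auto simp: Ch_add_closed Ch_zero_closed Ch_add_apply Ch_zero_apply\<close>)
  show "\<exists>y\<in>carrier Ch. y \<oplus>\<^bsub>Ch\<^esub> x = \<zero>\<^bsub>Ch\<^esub>" if x: "x \<in> carrier Ch" for x
  proof
    show y: "(\<lambda>q\<in>Pts. \<ominus> x q) \<in> carrier Ch" by (rule pointwise_closed[OF x]) auto
    show "(\<lambda>q\<in>Pts. \<ominus> x q) \<oplus>\<^bsub>Ch\<^esub> x = \<zero>\<^bsub>Ch\<^esub>"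
      by (rule chain_eqI) (use x y chain_coeff[OF x] in
        \<open>auto simp: Ch_add_closed Ch_zero_closed Ch_add_apply Ch_zero_apply l_neg\<close>)
  qed
qed

lemma Ch_minus_apply:
  assumes "x \<in> carrier Ch" "y \<in> carrier Ch" "q \<in> Pts"
  shows "(x \<ominus>\<^bsub>Ch\<^esub> y) q = x q \<ominus> y q"
proof -
  have "\<zero> = (y \<oplus>\<^bsub>Ch\<^esub> (\<ominus>\<^bsub>Ch\<^esub> y)) q"
    using assms by (simp add: Ch.r_neg Ch_zero_apply)
  then have "y q \<oplus> (\<ominus>\<^bsub>Ch\<^esub> y) q = \<zero>" using assms by (simp add: Ch_add_apply)
  then have "(\<ominus>\<^bsub>Ch\<^esub> y) q = \<ominus> y q"
    using assms chain_coeff[of y q] chain_coeff[of "\<ominus>\<^bsub>Ch\<^esub> y" q]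
    by (metis Ch.a_inv_closed a_comm minus_equality)
  then show ?thesis using assms by (simp add: Ch_add_apply a_minus_def[of Ch] a_minus_def[of R])
qed

text \<open>
Scaling by a ring element and restriction to a slice both act on each coefficient separately.
\<close>

lemma pointwise_endo:
  assumes "\<And>q a. q \<in> Pts \<Longrightarrow> a \<in> carrier R \<Longrightarrow> f q a \<in> carrier R"
    "\<And>q a b. q \<in> Pts \<Longrightarrow> a \<in> carrier R \<Longrightarrow> b \<in> carrier R \<Longrightarrow> f q (a \<oplus> b) = f q a \<oplus> f q b"
  shows "(\<lambda>x. \<lambda>q\<in>Pts. f q (x q)) \<in> Ch.endos"
proof -
  have z: "f q \<zero> = \<zero>" if "q \<in> Pts" for q
    using assms(2)[OF that, of \<zero> \<zero>] assms(1)[OF that, of \<zero>] by (simp add: add.l_cancel_one)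
  have closed: "(\<lambda>q\<in>Pts. f q (x q)) \<in> carrier Ch" if "x \<in> carrier Ch" for x
    using that assms(1) z by (rule pointwise_closed)
  moreover have "(\<lambda>q\<in>Pts. f q ((x \<oplus>\<^bsub>Ch\<^esub> y) q)) = (\<lambda>q\<in>Pts. f q (x q)) \<oplus>\<^bsub>Ch\<^esub> (\<lambda>q\<in>Pts. f q (y q))"
    if "x \<in> carrier Ch" "y \<in> carrier Ch" for x y
    using assms(2) that chain_coeff
    by (intro chain_eqI) (auto simp: closed Ch_add_closed Ch_add_apply)
  ultimately show ?thesis by (auto simp: hom_def)
qed

definition scale :: "'r \<Rightarrow> ('p \<Rightarrow> 'r) \<Rightarrow> 'p \<Rightarrow> 'r"
  where "scale r x = (\<lambda>q\<in>Pts. r \<otimes> x q)"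

definition translate :: "'g \<Rightarrow> ('p \<Rightarrow> 'r) \<Rightarrow> 'p \<Rightarrow> 'r"
  where "translate g x = (\<lambda>q\<in>Pts. x (pull g q))"

definition slice :: "real \<Rightarrow> ('p \<Rightarrow> 'r) \<Rightarrow> 'p \<Rightarrow> 'r"
  where "slice t x = (\<lambda>q\<in>Pts. if action c q = t then x q else \<zero>)"

text \<open>
This means that the level is at most \<open>t\<close>, without the maximum in the definition of the level.
\<close>

definition below :: "real \<Rightarrow> ('p \<Rightarrow> 'r) \<Rightarrow> bool"
  where "below t x \<longleftrightarrow> (\<forall>q\<in>Pts. action c q > t \<longrightarrow> x q = \<zero>)"

lemma scale_apply: "q \<in> Pts \<Longrightarrow> scale r x q = r \<otimes> x q"
  by (simp add: scale_def)

lemma translate_apply: "q \<in> Pts \<Longrightarrow> translate g x q = x (pull g q)"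
  by (simp add: translate_def)

lemma slice_apply: "q \<in> Pts \<Longrightarrow> slice t x q = (if action c q = t then x q else \<zero>)"
  by (simp add: slice_def)

lemma scale_endo: "r \<in> carrier R \<Longrightarrow> scale r \<in> Ch.endos"
  using pointwise_endo[of "\<lambda>_ a. r \<otimes> a"] by (simp add: scale_def[abs_def] r_distr)

lemma slice_endo: "slice t \<in> Ch.endos"
  using pointwise_endo[of "\<lambda>q a. if action c q = t then a else \<zero>"] by (simp add: slice_def[abs_def])

lemma translate_closed:
  assumes g: "g \<in> carrier Gam" and x: "x \<in> carrier Ch"
  shows "translate g x \<in> carrier Ch"
  unfolding chain_iff
proof (intro conjI allI)
  show "translate g x \<in> Pts \<rightarrow>\<^sub>E carrier R"
    using chain_coeff[OF x] pull_closed[OF g] by (auto simp: translate_def)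
  fix C
  have "{q \<in> Pts. translate g x q \<noteq> \<zero> \<and> action c q > C}
    \<subseteq> act c g ` {q \<in> Pts. x q \<noteq> \<zero> \<and> action c q > C + period c g}" (is "?A \<subseteq> _ ` ?B")
  proof
    fix q assume "q \<in> ?A"
    then have "pull g q \<in> ?B" "q = act c g (pull g q)"
      using pull_closed[OF g] action_pull[OF g] act_pull[OF g] by (auto simp: translate_def)
    then show "q \<in> act c g ` ?B" by blast
  qed
  then show "finite ?A" using chain_finite[OF x] finite_surj by blast
qed

lemma translate_endo: "g \<in> carrier Gam \<Longrightarrow> translate g \<in> Ch.endos"
proof -
  assume g: "g \<in> carrier Gam"
  have "translate g (x \<oplus>\<^bsub>Ch\<^esub> y) = translate g x \<oplus>\<^bsub>Ch\<^esub> translate g y"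
    if "x \<in> carrier Ch" "y \<in> carrier Ch" for x y
    by (rule chain_eqI)
      (use g that pull_closed[OF g] in \<open>auto simp: translate_closed Ch_add_closed Ch_add_apply translate_apply\<close>)
  with g show ?thesis by (auto simp: hom_def translate_closed)
qed

lemmas scale_closed = Ch.endos_closed[OF scale_endo]
lemmas slice_closed = Ch.endos_closed[OF slice_endo]

lemma translate_mult:
  "g \<in> carrier Gam \<Longrightarrow> h \<in> carrier Gam \<Longrightarrow> translate (g \<otimes>\<^bsub>Gam\<^esub> h) x = translate g (translate h x)"
  by (rule ext) (simp add: translate_def restrict_def pull_mult pull_closed)

lemma translate_one: "x \<in> carrier Ch \<Longrightarrow> translate \<one>\<^bsub>Gam\<^esub> x = x"
  by (rule chain_eqI) (auto simp: translate_closed, simp add: translate_def pull_one)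

lemma translate_scale: "g \<in> carrier Gam \<Longrightarrow> translate g (scale r x) = scale r (translate g x)"
  by (rule ext) (simp add: translate_def scale_def restrict_def pull_closed)

lemma translate_comm:
  "g \<in> carrier Gam \<Longrightarrow> h \<in> carrier Gam \<Longrightarrow> translate g (translate h x) = translate h (translate g x)"
  by (metis translate_mult Gam.m_comm)

section \<open>Finite chains form a Noetherian module\<close>

text \<open>
The operators that make chains a module over the subring generated by \<open>R\<close> and \<open>S\<close> in the group ring.
\<close>

definition ops :: "'g set \<Rightarrow> (('p \<Rightarrow> 'r) \<Rightarrow> 'p \<Rightarrow> 'r) set"
  where "ops S = scale ` carrier R \<union> translate ` S"

lemma ops_endos: "S \<subseteq> carrier Gam \<Longrightarrow> ops S \<subseteq> Ch.endos"
  using scale_endo translate_endo unfolding ops_def by blast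

lemma ops_insert: "ops (insert g S) = insert (translate g) (ops S)"
  by (auto simp: ops_def)

lemma translate_ops_comm:
  "g \<in> carrier Gam \<Longrightarrow> S \<subseteq> carrier Gam \<Longrightarrow> T \<in> ops S \<Longrightarrow> translate g (T x) = T (translate g x)"
  unfolding ops_def using translate_scale translate_comm by blast

abbreviation "generator \<equiv> floer_generator R c"

lemma generator_apply: "q \<in> Pts \<Longrightarrow> generator p q = (if q = p then \<one> else \<zero>)"
  by (simp add: floer_generator_def)

lemma generator_closed: "generator p \<in> carrier Ch"
  unfolding chain_iff
proof (intro conjI allI)
  show "generator p \<in> Pts \<rightarrow>\<^sub>E carrier R" by (auto simp: floer_generator_def)
  show "finite {q \<in> Pts. generator p q \<noteq> \<zero> \<and> action c q > C}" for C
    by (rule finite_subset[of _ "{p}"]) (auto simp: floer_generator_def)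
qed

lemma scale_minus:
  assumes "r \<in> carrier R" "s \<in> carrier R" "x \<in> carrier Ch"
  shows "scale (r \<ominus> s) x = scale r x \<ominus>\<^bsub>Ch\<^esub> scale s x"
  by (rule chain_eqI)
    (use assms chain_coeff[OF assms(3)] in \<open>auto simp: scale_closed Ch_minus_apply\<close>,
     use assms chain_coeff[OF assms(3)] in \<open>auto simp: scale_def a_minus_def l_distr l_minus\<close>)

lemma scale_add:
  assumes "r \<in> carrier R" "s \<in> carrier R" "x \<in> carrier Ch"
  shows "scale (r \<oplus> s) x = scale r x \<oplus>\<^bsub>Ch\<^esub> scale s x"
  by (rule chain_eqI)
    (use assms chain_coeff[OF assms(3)] in \<open>auto simp: scale_closed Ch_add_apply\<close>,
     use assms chain_coeff[OF assms(3)] in \<open>auto simp: scale_def l_distr\<close>)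

lemma scale_scale:
  assumes "r \<in> carrier R" "s \<in> carrier R" "x \<in> carrier Ch"
  shows "scale (r \<otimes> s) x = scale r (scale s x)"
  by (rule chain_eqI)
    (use assms chain_coeff[OF assms(3)] in \<open>auto simp: scale_closed\<close>,
     use assms chain_coeff[OF assms(3)] in \<open>auto simp: scale_def m_assoc\<close>)

lemma scale_zero: "x \<in> carrier Ch \<Longrightarrow> scale \<zero> x = \<zero>\<^bsub>Ch\<^esub>"
  by (rule chain_eqI) (auto simp: scale_closed, auto simp: scale_def Ch_zero_apply chain_coeff)

lemma scale_one: "x \<in> carrier Ch \<Longrightarrow> scale \<one> x = x"
  by (rule chain_eqI) (auto simp: scale_closed, auto simp: scale_def chain_coeff)

lemma cyclic_subgroup: "x \<in> carrier Ch \<Longrightarrow> Ch.op_subgroup (ops {}) {scale r x | r. r \<in> carrier R}"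
  unfolding Ch.op_subgroup_def
proof (intro conjI ballI)
  assume x: "x \<in> carrier Ch"
  show "{scale r x | r. r \<in> carrier R} \<subseteq> carrier Ch" using x scale_closed by auto
  show "\<zero>\<^bsub>Ch\<^esub> \<in> {scale r x | r. r \<in> carrier R}" using scale_zero[OF x, symmetric] by auto
  fix y assume y: "y \<in> {scale r x | r. r \<in> carrier R}"
  show "y \<ominus>\<^bsub>Ch\<^esub> z \<in> {scale r x | r. r \<in> carrier R}" if "z \<in> {scale r x | r. r \<in> carrier R}" for z
  proof -
    obtain r s where "y = scale r x" "r \<in> carrier R" "z = scale s x" "s \<in> carrier R" using y \<open>z \<in> _\<close> by auto
    then show ?thesis using scale_minus[of r s x, symmetric] x minus_closed by auto
  qed
  show "T y \<in> {scale r x | r. r \<in> carrier R}" if T: "T \<in> ops {}" for T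
  proof -
    obtain r where "y = scale r x" "r \<in> carrier R" using y by blast
    moreover obtain s where "T = scale s" "s \<in> carrier R" using T by (auto simp: ops_def)
    ultimately show ?thesis using scale_scale[of s r x, symmetric] x m_closed by auto
  qed
qed

text \<open>
An operator subgroup of the cyclic module \<open>R x\<close> corresponds to the ideal of its coefficients, so
this is where the hypothesis on the ring \<open>R\<close> is used.
\<close>

lemma cyclic_noetherian:
  assumes x: "x \<in> carrier Ch"
  shows "Ch.op_noetherian (ops {}) {scale r x | r. r \<in> carrier R}"
  unfolding Ch.op_noetherian_def
proof (intro allI impI)
  fix N assume N: "Ch.op_subgroup (ops {}) N" "N \<subseteq> {scale r x | r. r \<in> carrier R}"
  have ideal_coeffs: "ideal {r \<in> carrier R. scale r x \<in> M} R" if M: "Ch.op_subgroup (ops {}) M" for M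
  proof (rule idealI)
    show "ring R" by (rule ring_axioms)
    have m: "scale s (scale r x) \<in> M" if "scale r x \<in> M" "s \<in> carrier R" for r s
      using Ch.op_subgroupD(4)[OF M _ that(1), of "scale s"] that by (auto simp: ops_def)
    show "subgroup {r \<in> carrier R. scale r x \<in> M} (add_monoid R)"
    proof (rule add.subgroupI)
      show "{r \<in> carrier R. scale r x \<in> M} \<noteq> {}"
        using Ch.op_subgroupD(2)[OF M] scale_zero[OF x] by (auto intro!: exI[of _ \<zero>])
      fix r assume r: "r \<in> {r \<in> carrier R. scale r x \<in> M}"
      have "scale (\<ominus> r) x = \<zero>\<^bsub>Ch\<^esub> \<ominus>\<^bsub>Ch\<^esub> scale r x"
        using scale_minus[of \<zero> r x] scale_zero[OF x] r x by (simp add: a_minus_def[of R])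
      then show "\<ominus> r \<in> {r \<in> carrier R. scale r x \<in> M}"
        using r Ch.op_subgroupD(3)[OF M Ch.op_subgroupD(2)[OF M]] by auto
      fix s assume "s \<in> {r \<in> carrier R. scale r x \<in> M}"
      then show "r \<oplus> s \<in> {r \<in> carrier R. scale r x \<in> M}"
        using r Ch.op_subgroup_add[OF M] scale_add[of r s x] x by auto
    qed auto
    fix a s assume a: "a \<in> {r \<in> carrier R. scale r x \<in> M}" and s: "s \<in> carrier R"
    show "s \<otimes> a \<in> {r \<in> carrier R. scale r x \<in> M}"
      using a s m scale_scale[of s a x] x by auto
    then show "a \<otimes> s \<in> {r \<in> carrier R. scale r x \<in> M}"
      using m_comm[of a s] a s by auto
  qed
  obtain B where B: "B \<subseteq> carrier R" "finite B" "{r \<in> carrier R. scale r x \<in> N} = Idl B"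
    using finetely_gen[OF ideal_coeffs[OF N(1)]] by blast
  let ?F = "(\<lambda>r. scale r x) ` B"
  have "B \<subseteq> {r \<in> carrier R. scale r x \<in> N}" using genideal_self[OF B(1)] B(3) by simp
  then have FN: "?F \<subseteq> N" by auto
  have sp: "Ch.op_subgroup (ops {}) (Ch.op_span (ops {}) ?F)"
    using FN Ch.op_subgroupD(1)[OF N(1)] by (intro Ch.op_subgroup_op_span ops_endos) auto
  have "B \<subseteq> {r \<in> carrier R. scale r x \<in> Ch.op_span (ops {}) ?F}"
    using B(1) by (auto intro: Ch.op_span.gen)
  then have "Idl B \<subseteq> {r \<in> carrier R. scale r x \<in> Ch.op_span (ops {}) ?F}"
    by (rule genideal_minimal[OF ideal_coeffs[OF sp]])
  then have "N \<subseteq> Ch.op_span (ops {}) ?F" using B(3) N(2) by blast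
  then show "\<exists>F. finite F \<and> F \<subseteq> N \<and> N \<subseteq> Ch.op_span (ops {}) F" using B(2) FN by blast
qed

lemma finite_span_noetherian:
  assumes "finite B"
  shows "\<exists>V. Ch.op_subgroup (ops {}) V \<and> Ch.op_noetherian (ops {}) V \<and> generator ` B \<subseteq> V"
  using assms
proof (induction B)
  case empty
  have "Ch.op_subgroup (ops {}) {scale r \<zero>\<^bsub>Ch\<^esub> | r. r \<in> carrier R}" "Ch.op_noetherian (ops {}) {scale r \<zero>\<^bsub>Ch\<^esub> | r. r \<in> carrier R}"
    using cyclic_subgroup[OF Ch_zero_closed] cyclic_noetherian[OF Ch_zero_closed] by auto
  then show ?case by blast
next
  case (insert p B)
  then obtain V where V: "Ch.op_subgroup (ops {}) V" "Ch.op_noetherian (ops {}) V" "generator ` B \<subseteq> V" by blast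
  define L where "L = {scale r (generator p) | r. r \<in> carrier R}"
  have L: "Ch.op_subgroup (ops {}) L" "Ch.op_noetherian (ops {}) L"
    unfolding L_def using cyclic_subgroup cyclic_noetherian generator_closed by blast+
  have id: "(\<lambda>x. x) \<in> Ch.endos" by (auto simp: hom_def)
  let ?W = "{y \<oplus>\<^bsub>Ch\<^esub> z | y z. y \<in> V \<and> z \<in> L}"
  have e: "ops {} \<subseteq> Ch.endos" by (rule ops_endos) auto
  have W: "Ch.op_subgroup (ops {}) ?W" "Ch.op_noetherian (ops {}) ?W"
    using Ch.op_subgroup_sum[OF e id _ V(1) L(1)] Ch.op_noetherian_sum[OF e V(1,2) L] by auto
  have "scale \<one> (generator p) \<in> L" unfolding L_def by auto
  then have gp: "generator p \<in> L" using scale_one generator_closed by simp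
  have "\<zero>\<^bsub>Ch\<^esub> \<oplus>\<^bsub>Ch\<^esub> generator p \<in> ?W" using Ch.op_subgroupD(2)[OF V(1)] gp by blast
  then have "generator p \<in> ?W" using generator_closed by simp
  moreover have "v \<in> ?W" if "v \<in> V" for v
  proof -
    have "v \<oplus>\<^bsub>Ch\<^esub> \<zero>\<^bsub>Ch\<^esub> \<in> ?W" using that Ch.op_subgroupD(2)[OF L(1)] by blast
    moreover have "v \<in> carrier Ch" using Ch.op_subgroupD(1)[OF V(1)] that by blast
    ultimately show ?thesis by simp
  qed
  ultimately have "generator ` insert p B \<subseteq> ?W" using V(3) by blast
  with W show ?case by blast
qed

lemma translates_noetherian:
  assumes "finite S" "S \<subseteq> carrier Gam" "finite B"
  shows "\<exists>V. Ch.op_subgroup (ops S) V \<and> Ch.op_noetherian (ops S) V \<and> generator ` B \<subseteq> V"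
  using assms(1,2)
proof (induction S)
  case empty
  then show ?case using finite_span_noetherian[OF assms(3)] by simp
next
  case (insert g S)
  then obtain V where V: "Ch.op_subgroup (ops S) V" "Ch.op_noetherian (ops S) V" "generator ` B \<subseteq> V" by auto
  have g: "g \<in> carrier Gam" "S \<subseteq> carrier Gam" using insert by auto
  note * = ops_endos[OF g(2)] translate_endo[OF g(1)] translate_ops_comm[OF g] V(1)
  show ?case
    using Ch.poly_subgroup[OF *] Ch.poly_noetherian[OF * V(2)] Ch.poly_superset[OF *] V(3)
    unfolding ops_insert by blast
qed

lemma translate_generator:
  assumes "g \<in> carrier Gam" "p \<in> Pts"
  shows "translate g (generator p) = generator (act c g p)"
proof -
  have "pull g q = p \<longleftrightarrow> q = act c g p" if "q \<in> Pts" for q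
    using assms that act_pull pull_act by metis
  then show ?thesis
    using assms pull_closed by (auto simp: translate_def floer_generator_def)
qed

lemma finite_support_mem:
  assumes V: "Ch.op_subgroup (ops S) V" "\<And>q. q \<in> Pts \<Longrightarrow> generator q \<in> V"
    and B: "finite B" and x: "x \<in> carrier Ch" "\<And>q. q \<in> Pts \<Longrightarrow> q \<notin> B \<Longrightarrow> x q = \<zero>"
  shows "x \<in> V"
  using B x
proof (induction B arbitrary: x)
  case empty
  then have "x = \<zero>\<^bsub>Ch\<^esub>" by (intro chain_eqI) (auto simp: Ch_zero_apply)
  then show ?case using Ch.op_subgroupD(2)[OF V(1)] by simp
next
  case (insert p B)
  show ?case
  proof (cases "p \<in> Pts")
    case False
    then show ?thesis using insert.IH[OF insert.prems(1)] insert.prems(2) by blast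
  next
    case True
    have c: "x p \<in> carrier R" using chain_coeff insert.prems(1) True by blast
    let ?y = "scale (x p) (generator p)"
    have y: "?y \<in> carrier Ch" using scale_closed[OF c] generator_closed by blast
    have "?y \<in> V" using Ch.op_subgroupD(4)[OF V(1) _ V(2)[OF True]] c by (auto simp: ops_def)
    moreover have "x \<ominus>\<^bsub>Ch\<^esub> ?y \<in> V"
    proof (rule insert.IH)
      show "x \<ominus>\<^bsub>Ch\<^esub> ?y \<in> carrier Ch" using insert.prems(1) y by simp
      fix q assume "q \<in> Pts" "q \<notin> B"
      then show "(x \<ominus>\<^bsub>Ch\<^esub> ?y) q = \<zero>"
        using insert.prems(2)[of q] c True
        by (auto simp: Ch_minus_apply[OF insert.prems(1) y] scale_apply generator_apply r_neg a_minus_def[of R])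
    qed
    ultimately have "(x \<ominus>\<^bsub>Ch\<^esub> ?y) \<oplus>\<^bsub>Ch\<^esub> ?y \<in> V" using Ch.op_subgroup_add[OF V(1)] by blast
    then show ?thesis using Ch.minus_add_cancel insert.prems(1) y by simp
  qed
qed

text \<open>
One point per orbit gives a module of finite rank over \<open>R\<close>.  Adjoining the translations by finitely
many group generators and their inverses produces a Noetherian subgroup which contains all
points, hence all finite chains.
\<close>

lemma finite_chains_noetherian:
  "\<exists>S V. S \<subseteq> carrier Gam \<and> Ch.op_subgroup (ops S) V \<and> Ch.op_noetherian (ops S) V \<and>
    {x \<in> carrier Ch. finite {q \<in> Pts. x q \<noteq> \<zero>}} \<subseteq> V"
proof -
  obtain A where A: "finite A" "A \<subseteq> carrier Gam" "generate Gam A = carrier Gam"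
    using complexD(1) by blast
  define S where "S = A \<union> m_inv Gam ` A"
  have S: "finite S" "S \<subseteq> carrier Gam" using A by (auto simp: S_def)
  note fin = complexD(2)
  have orb: "q \<in> orbit Gam (act c) p" if "p \<in> Pts" "q \<in> Pts" "bproj c p = bproj c q" for p q
    using complexD(4) that by metis
  have "\<exists>p. p \<in> Pts \<and> bproj c p = s" if "s \<in> base c" for s
    using that unfolding complexD(3)[symmetric] by blast
  then obtain rep where rep: "\<And>s. s \<in> base c \<Longrightarrow> rep s \<in> Pts \<and> bproj c (rep s) = s" by metis
  have "finite (rep ` base c)" using fin by simp
  from translates_noetherian[OF S this]
  obtain V where V: "Ch.op_subgroup (ops S) V" "Ch.op_noetherian (ops S) V" "generator ` rep ` base c \<subseteq> V"
    by blast
  note VC = Ch.op_subgroupD(1)[OF V(1), THEN subsetD]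
  have VS: "translate g x \<in> V" if "g \<in> S" "x \<in> V" for g x
    using Ch.op_subgroupD(4)[OF V(1) _ that(2)] that(1) by (auto simp: ops_def)
  have VT: "g \<in> carrier Gam \<and> (\<forall>x\<in>V. translate g x \<in> V)" if "g \<in> generate Gam A" for g
    using that
  proof (induction rule: generate.induct)
    case one
    then show ?case using translate_one VC by auto
  next
    case (incl h)
    then show ?case using VS[of h] A(2) by (auto simp: S_def)
  next
    case (inv h)
    then show ?case using VS[of "inv\<^bsub>Gam\<^esub> h"] A(2) by (auto simp: S_def)
  next
    case (eng g h)
    then show ?case by (auto simp: translate_mult)
  qed
  have "generator q \<in> V" if q: "q \<in> Pts" for q
  proof -
    have b: "bproj c q \<in> base c" unfolding complexD(3)[symmetric] using q by blast
    then have r: "rep (bproj c q) \<in> Pts" "bproj c (rep (bproj c q)) = bproj c q" using rep by auto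
    then obtain g where g: "g \<in> carrier Gam" "q = act c g (rep (bproj c q))"
      using orb[OF r(1) q] by (auto simp: orbit_def)
    have "translate g (generator (rep (bproj c q))) \<in> V" using VT A(3) g(1) V(3) b by blast
    then show ?thesis using translate_generator[OF g(1) r(1)] g(2) by simp
  qed
  from finite_support_mem[OF V(1) this]
  have "x \<in> V" if "x \<in> carrier Ch" "finite {q \<in> Pts. x q \<noteq> \<zero>}" for x
    using that(2,1) by auto
  then show ?thesis using S(2) V by blast
qed

section \<open>Novikov combinations of chains\<close>

lemma nov_iff:
  "b \<in> carrier Nov \<longleftrightarrow> b \<in> carrier Gam \<rightarrow>\<^sub>E carrier R \<and>
    (\<forall>C. finite {g \<in> carrier Gam. b g \<noteq> \<zero> \<and> period c g < C})"
  by (simp add: novikov_ring_def)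

lemma nov_coeff: "b \<in> carrier Nov \<Longrightarrow> g \<in> carrier Gam \<Longrightarrow> b g \<in> carrier R"
  by (auto simp: nov_iff)

lemma nov_finite: "b \<in> carrier Nov \<Longrightarrow> finite {g \<in> carrier Gam. b g \<noteq> \<zero> \<and> period c g < C}"
  by (simp add: nov_iff)

lemma nov_mono_support:
  assumes "b \<in> carrier Nov" "b' \<in> carrier Gam \<rightarrow>\<^sub>E carrier R"
    "\<And>g. g \<in> carrier Gam \<Longrightarrow> b g = \<zero> \<Longrightarrow> b' g = \<zero>"
  shows "b' \<in> carrier Nov"
  unfolding nov_iff
proof (intro conjI allI)
  fix C show "finite {g \<in> carrier Gam. b' g \<noteq> \<zero> \<and> period c g < C}"
    by (rule finite_subset[OF _ nov_finite[OF assms(1), of C]]) (use assms(3) in auto)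
qed (rule assms(2))

lemma nov_zero: "(\<lambda>g\<in>carrier Gam. \<zero>) \<in> carrier Nov"
  unfolding nov_iff by (auto cong: conj_cong)

lemma nov_add: "b \<oplus>\<^bsub>Nov\<^esub> b' = (\<lambda>g\<in>carrier Gam. b g \<oplus> b' g)"
  by (simp add: novikov_ring_def)

lemma nov_add_closed: "b \<in> carrier Nov \<Longrightarrow> b' \<in> carrier Nov \<Longrightarrow> b \<oplus>\<^bsub>Nov\<^esub> b' \<in> carrier Nov"
  unfolding nov_iff[of "b \<oplus>\<^bsub>Nov\<^esub> b'"]
proof (intro conjI allI)
  assume b: "b \<in> carrier Nov" "b' \<in> carrier Nov"
  show "b \<oplus>\<^bsub>Nov\<^esub> b' \<in> carrier Gam \<rightarrow>\<^sub>E carrier R"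
    using nov_coeff[OF b(1)] nov_coeff[OF b(2)] by (simp add: nov_add)
  fix C
  have "{g \<in> carrier Gam. (b \<oplus>\<^bsub>Nov\<^esub> b') g \<noteq> \<zero> \<and> period c g < C}
    \<subseteq> {g \<in> carrier Gam. b g \<noteq> \<zero> \<and> period c g < C} \<union> {g \<in> carrier Gam. b' g \<noteq> \<zero> \<and> period c g < C}"
    by (auto simp: nov_add)
  then show "finite {g \<in> carrier Gam. (b \<oplus>\<^bsub>Nov\<^esub> b') g \<noteq> \<zero> \<and> period c g < C}"
    using finite_subset nov_finite[OF b(1)] nov_finite[OF b(2)] by (meson finite_UnI)
qed

text \<open>
The index set of the sum that defines the coefficient at \<open>q\<close> of the product of \<open>b\<close> and \<open>x\<close>.
\<close>

definition terms_at :: "('g \<Rightarrow> 'r) \<Rightarrow> ('p \<Rightarrow> 'r) \<Rightarrow> 'p \<Rightarrow> 'g set"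
  where "terms_at b x q = {g \<in> carrier Gam. b g \<noteq> \<zero> \<and> x (pull g q) \<noteq> \<zero>}"

lemma smult_eq: "b \<odot>\<^bsub>Ch\<^esub> x = (\<lambda>q\<in>Pts. \<Oplus>g\<in>terms_at b x q. b g \<otimes> x (pull g q))"
  by (simp add: floer_chains_def terms_at_def pull_def)

lemma smult_apply: "q \<in> Pts \<Longrightarrow> (b \<odot>\<^bsub>Ch\<^esub> x) q = (\<Oplus>g\<in>terms_at b x q. b g \<otimes> x (pull g q))"
  by (simp add: smult_eq)

lemma term_closed:
  "b \<in> carrier Nov \<Longrightarrow> x \<in> carrier Ch \<Longrightarrow> q \<in> Pts \<Longrightarrow> g \<in> carrier Gam \<Longrightarrow> b g \<otimes> x (pull g q) \<in> carrier R"
  by (intro m_closed nov_coeff chain_coeff pull_closed)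

text \<open>
The Novikov condition bounds the number of terms with period below \<open>1\<close>.  A term of positive period
comes from a point of \<open>x\<close> with action above that of \<open>q\<close>; there are finitely many such points, and
each occurs for one \<open>g\<close> because the action of the group is free.
\<close>

lemma finite_terms_at:
  assumes b: "b \<in> carrier Nov" and x: "x \<in> carrier Ch" and q: "q \<in> Pts"
  shows "finite (terms_at b x q)"
proof -
  let ?A = "{g \<in> carrier Gam. x (pull g q) \<noteq> \<zero> \<and> period c g > 0}"
  have "(\<lambda>g. pull g q) ` ?A \<subseteq> {p \<in> Pts. x p \<noteq> \<zero> \<and> action c p > action c q}"
    using q by (auto simp: pull_closed action_pull)
  moreover have "inj_on (\<lambda>g. pull g q) ?A"
    using pull_inj q by (auto simp: inj_on_def)
  ultimately have "finite ?A" using chain_finite[OF x] inj_on_finite by blast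
  moreover have "finite {g \<in> carrier Gam. b g \<noteq> \<zero> \<and> period c g < 1}" by (rule nov_finite[OF b])
  moreover have "terms_at b x q \<subseteq> ?A \<union> {g \<in> carrier Gam. b g \<noteq> \<zero> \<and> period c g < 1}"
    by (auto simp: terms_at_def)
  ultimately show ?thesis by (meson finite_UnI finite_subset)
qed

text \<open>
Enlarging the index set by zero terms allows sums for different coefficients to be compared
term by term.
\<close>

lemma smult_apply_superset:
  assumes b: "b \<in> carrier Nov" and x: "x \<in> carrier Ch" and q: "q \<in> Pts"
    and S: "finite S" "terms_at b x q \<subseteq> S" "S \<subseteq> carrier Gam"
  shows "(b \<odot>\<^bsub>Ch\<^esub> x) q = (\<Oplus>g\<in>S. b g \<otimes> x (pull g q))"
  unfolding smult_apply[OF q]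
proof (rule add.finprod_mono_neutral_cong_left[OF S(1,2)])
  show "b g \<otimes> x (pull g q) = \<zero>" if "g \<in> S - terms_at b x q" for g
  proof -
    have g: "g \<in> carrier Gam" using that S by auto
    then have "b g = \<zero> \<or> x (pull g q) = \<zero>" using that by (auto simp: terms_at_def)
    then show ?thesis using nov_coeff[OF b g] chain_coeff[OF x pull_closed[OF g q]] by auto
  qed
qed (use S term_closed[OF b x q] in auto)

lemma smult_zero_at:
  assumes "q \<in> Pts" "\<And>g. g \<in> carrier Gam \<Longrightarrow> b g \<noteq> \<zero> \<Longrightarrow> x (pull g q) = \<zero>"
  shows "(b \<odot>\<^bsub>Ch\<^esub> x) q = \<zero>"
proof -
  have "terms_at b x q = {}" using assms(2) by (auto simp: terms_at_def)
  then show ?thesis by (simp add: smult_apply[OF assms(1)])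
qed

lemma chain_bounded:
  assumes x: "x \<in> carrier Ch"
  obtains t where "below t x"
proof
  let ?S = "action c ` {q \<in> Pts. x q \<noteq> \<zero> \<and> action c q > 0}"
  have fin: "finite (insert 0 ?S)" using chain_finite[OF x] by auto
  show "below (Max (insert 0 ?S)) x"
    unfolding below_def
  proof (intro ballI impI)
    fix q assume q: "q \<in> Pts" "action c q > Max (insert 0 ?S)"
    then have "action c q > 0" "action c q \<notin> ?S" using fin by auto
    then show "x q = \<zero>" using q(1) by auto
  qed
qed

lemma smult_closed:
  assumes b: "b \<in> carrier Nov" and x: "x \<in> carrier Ch"
  shows "b \<odot>\<^bsub>Ch\<^esub> x \<in> carrier Ch"
  unfolding chain_iff
proof (intro conjI allI)
  show "b \<odot>\<^bsub>Ch\<^esub> x \<in> Pts \<rightarrow>\<^sub>E carrier R"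
    unfolding smult_eq using term_closed[OF b x] by (auto intro!: finsum_closed simp: terms_at_def)
  fix C
  obtain t where t: "below t x" using chain_bounded[OF x] by blast
  let ?G = "{g \<in> carrier Gam. b g \<noteq> \<zero> \<and> period c g < t - C}"
  let ?P = "\<lambda>g. {p \<in> Pts. x p \<noteq> \<zero> \<and> action c p > C + period c g}"
  have "{q \<in> Pts. (b \<odot>\<^bsub>Ch\<^esub> x) q \<noteq> \<zero> \<and> action c q > C} \<subseteq> (\<Union>g\<in>?G. act c g ` ?P g)"
  proof
    fix q assume "q \<in> {q \<in> Pts. (b \<odot>\<^bsub>Ch\<^esub> x) q \<noteq> \<zero> \<and> action c q > C}"
    then have q: "q \<in> Pts" "(b \<odot>\<^bsub>Ch\<^esub> x) q \<noteq> \<zero>" "action c q > C" by auto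
    then obtain g where g: "g \<in> carrier Gam" "b g \<noteq> \<zero>" "x (pull g q) \<noteq> \<zero>"
      using smult_zero_at[of q b x] by blast
    have "action c (pull g q) \<le> t" using t g pull_closed[OF g(1) q(1)] by (force simp: below_def)
    then have "g \<in> ?G" "pull g q \<in> ?P g" "q = act c g (pull g q)"
      using g q pull_closed action_pull act_pull by auto
    then show "q \<in> (\<Union>g\<in>?G. act c g ` ?P g)" by blast
  qed
  moreover have "finite (\<Union>g\<in>?G. act c g ` ?P g)"
    using nov_finite[OF b] chain_finite[OF x] by blast
  ultimately show "finite {q \<in> Pts. (b \<odot>\<^bsub>Ch\<^esub> x) q \<noteq> \<zero> \<and> action c q > C}"
    by (rule finite_subset)
qed

lemma smult_add:
  assumes b: "b \<in> carrier Nov" and b': "b' \<in> carrier Nov" and x: "x \<in> carrier Ch"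
  shows "(b \<oplus>\<^bsub>Nov\<^esub> b') \<odot>\<^bsub>Ch\<^esub> x = b \<odot>\<^bsub>Ch\<^esub> x \<oplus>\<^bsub>Ch\<^esub> b' \<odot>\<^bsub>Ch\<^esub> x"
proof (rule chain_eqI)
  note bb = nov_add_closed[OF b b']
  show "(b \<oplus>\<^bsub>Nov\<^esub> b') \<odot>\<^bsub>Ch\<^esub> x \<in> carrier Ch" "b \<odot>\<^bsub>Ch\<^esub> x \<oplus>\<^bsub>Ch\<^esub> b' \<odot>\<^bsub>Ch\<^esub> x \<in> carrier Ch"
    using bb b b' x smult_closed by auto
  fix q assume q: "q \<in> Pts"
  let ?S = "terms_at b x q \<union> terms_at b' x q \<union> terms_at (b \<oplus>\<^bsub>Nov\<^esub> b') x q"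
  have S: "finite ?S" "?S \<subseteq> carrier Gam"
    using finite_terms_at[OF _ x q] b b' bb by (auto simp: terms_at_def)
  have "((b \<oplus>\<^bsub>Nov\<^esub> b') \<odot>\<^bsub>Ch\<^esub> x) q = (\<Oplus>g\<in>?S. (b \<oplus>\<^bsub>Nov\<^esub> b') g \<otimes> x (pull g q))"
    using S by (intro smult_apply_superset[OF bb x q]) auto
  also have "\<dots> = (\<Oplus>g\<in>?S. b g \<otimes> x (pull g q) \<oplus> b' g \<otimes> x (pull g q))"
  proof (rule finsum_cong')
    fix g assume "g \<in> ?S"
    then have g: "g \<in> carrier Gam" using S by blast
    show "(b \<oplus>\<^bsub>Nov\<^esub> b') g \<otimes> x (pull g q) = b g \<otimes> x (pull g q) \<oplus> b' g \<otimes> x (pull g q)"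
      using g nov_coeff[OF b g] nov_coeff[OF b' g] chain_coeff[OF x pull_closed[OF g q]]
      by (simp add: nov_add l_distr)
  qed (use S term_closed[OF b x q] term_closed[OF b' x q] in auto)
  also have "\<dots> = (\<Oplus>g\<in>?S. b g \<otimes> x (pull g q)) \<oplus> (\<Oplus>g\<in>?S. b' g \<otimes> x (pull g q))"
    using S term_closed[OF b x q] term_closed[OF b' x q] by (intro finsum_addf) auto
  also have "(\<Oplus>g\<in>?S. b g \<otimes> x (pull g q)) = (b \<odot>\<^bsub>Ch\<^esub> x) q"
    using S by (intro smult_apply_superset[OF b x q, symmetric]) auto
  also have "(\<Oplus>g\<in>?S. b' g \<otimes> x (pull g q)) = (b' \<odot>\<^bsub>Ch\<^esub> x) q"
    using S by (intro smult_apply_superset[OF b' x q, symmetric]) auto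
  finally show "((b \<oplus>\<^bsub>Nov\<^esub> b') \<odot>\<^bsub>Ch\<^esub> x) q = (b \<odot>\<^bsub>Ch\<^esub> x \<oplus>\<^bsub>Ch\<^esub> b' \<odot>\<^bsub>Ch\<^esub> x) q"
    using q by (simp add: Ch_add_apply)
qed

lemma smult_zero:
  assumes "x \<in> carrier Ch"
  shows "(\<lambda>g\<in>carrier Gam. \<zero>) \<odot>\<^bsub>Ch\<^esub> x = \<zero>\<^bsub>Ch\<^esub>"
  by (rule chain_eqI[OF smult_closed[OF nov_zero assms] Ch_zero_closed])
    (auto simp: Ch_zero_apply intro!: smult_zero_at)

definition nov_scale :: "'r \<Rightarrow> ('g \<Rightarrow> 'r) \<Rightarrow> 'g \<Rightarrow> 'r"
  where "nov_scale r b = (\<lambda>g\<in>carrier Gam. r \<otimes> b g)"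

definition nov_translate :: "'g \<Rightarrow> ('g \<Rightarrow> 'r) \<Rightarrow> 'g \<Rightarrow> 'r"
  where "nov_translate h b = (\<lambda>g\<in>carrier Gam. b (inv\<^bsub>Gam\<^esub> h \<otimes>\<^bsub>Gam\<^esub> g))"

abbreviation nov_one :: "'g \<Rightarrow> 'r"
  where "nov_one \<equiv> \<one>\<^bsub>Nov\<^esub>"

lemma nov_one_def: "nov_one = (\<lambda>g\<in>carrier Gam. if g = \<one>\<^bsub>Gam\<^esub> then \<one> else \<zero>)"
  by (simp add: novikov_ring_def)

lemma nov_one_closed: "nov_one \<in> carrier Nov"
  unfolding nov_iff
proof (intro conjI allI)
  show "nov_one \<in> carrier Gam \<rightarrow>\<^sub>E carrier R" by (auto simp: nov_one_def)
  show "finite {g \<in> carrier Gam. nov_one g \<noteq> \<zero> \<and> period c g < C}" for C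
    by (rule finite_subset[of _ "{\<one>\<^bsub>Gam\<^esub>}"]) (auto simp: nov_one_def)
qed

lemma smult_one:
  assumes x: "x \<in> carrier Ch"
  shows "nov_one \<odot>\<^bsub>Ch\<^esub> x = x"
proof (rule chain_eqI[OF smult_closed[OF nov_one_closed x] x])
  fix q assume q: "q \<in> Pts"
  have "(nov_one \<odot>\<^bsub>Ch\<^esub> x) q = (\<Oplus>g\<in>{\<one>\<^bsub>Gam\<^esub>}. nov_one g \<otimes> x (pull g q))"
    by (rule smult_apply_superset[OF nov_one_closed x q]) (auto simp: terms_at_def nov_one_def split: if_splits)
  then show "(nov_one \<odot>\<^bsub>Ch\<^esub> x) q = x q"
    using chain_coeff[OF x q] by (simp add: nov_one_def pull_one[OF q])
qed

lemma nov_scale_closed: "r \<in> carrier R \<Longrightarrow> b \<in> carrier Nov \<Longrightarrow> nov_scale r b \<in> carrier Nov"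
  using nov_coeff[of b] by - (rule nov_mono_support[of b], auto simp: nov_scale_def)

lemma smult_scale:
  assumes r: "r \<in> carrier R" and b: "b \<in> carrier Nov" and x: "x \<in> carrier Ch"
  shows "nov_scale r b \<odot>\<^bsub>Ch\<^esub> x = scale r (b \<odot>\<^bsub>Ch\<^esub> x)"
proof (rule chain_eqI)
  note rb = nov_scale_closed[OF r b]
  show "nov_scale r b \<odot>\<^bsub>Ch\<^esub> x \<in> carrier Ch" "scale r (b \<odot>\<^bsub>Ch\<^esub> x) \<in> carrier Ch"
    using rb b x r smult_closed scale_closed by auto
  fix q assume q: "q \<in> Pts"
  have S: "finite (terms_at b x q)" "terms_at b x q \<subseteq> carrier Gam"
    using finite_terms_at[OF b x q] by (auto simp: terms_at_def)
  have "terms_at (nov_scale r b) x q \<subseteq> terms_at b x q"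
    using r by (auto simp: terms_at_def nov_scale_def)
  then have "(nov_scale r b \<odot>\<^bsub>Ch\<^esub> x) q = (\<Oplus>g\<in>terms_at b x q. nov_scale r b g \<otimes> x (pull g q))"
    using S by (intro smult_apply_superset[OF rb x q]) auto
  also have "\<dots> = (\<Oplus>g\<in>terms_at b x q. r \<otimes> (b g \<otimes> x (pull g q)))"
  proof (rule finsum_cong')
    fix g assume "g \<in> terms_at b x q"
    then have g: "g \<in> carrier Gam" using S by blast
    show "nov_scale r b g \<otimes> x (pull g q) = r \<otimes> (b g \<otimes> x (pull g q))"
      using g r nov_coeff[OF b g] chain_coeff[OF x pull_closed[OF g q]] by (simp add: nov_scale_def m_assoc)
  qed (use S r term_closed[OF b x q] in auto)
  also have "\<dots> = r \<otimes> (\<Oplus>g\<in>terms_at b x q. b g \<otimes> x (pull g q))"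
    using S r term_closed[OF b x q] by (intro finsum_rdistr[symmetric]) auto
  finally show "(nov_scale r b \<odot>\<^bsub>Ch\<^esub> x) q = scale r (b \<odot>\<^bsub>Ch\<^esub> x) q"
    using q by (simp add: scale_apply smult_apply)
qed

lemma nov_translate_closed:
  assumes h: "h \<in> carrier Gam" and b: "b \<in> carrier Nov"
  shows "nov_translate h b \<in> carrier Nov"
  unfolding nov_iff
proof (intro conjI allI)
  show "nov_translate h b \<in> carrier Gam \<rightarrow>\<^sub>E carrier R"
    using nov_coeff[OF b] h by (auto simp: nov_translate_def)
  fix C
  have "{g \<in> carrier Gam. nov_translate h b g \<noteq> \<zero> \<and> period c g < C}
    \<subseteq> (\<lambda>g. h \<otimes>\<^bsub>Gam\<^esub> g) ` {g \<in> carrier Gam. b g \<noteq> \<zero> \<and> period c g < C - period c h}" (is "?A \<subseteq> _ ` ?B")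
  proof
    fix g assume g: "g \<in> ?A"
    let ?k = "inv\<^bsub>Gam\<^esub> h \<otimes>\<^bsub>Gam\<^esub> g"
    have "?k \<in> ?B" using g h by (auto simp: nov_translate_def period_mult period_inv)
    moreover have "g = h \<otimes>\<^bsub>Gam\<^esub> ?k" using g h by (simp add: Gam.m_assoc[symmetric])
    ultimately show "g \<in> (\<lambda>g. h \<otimes>\<^bsub>Gam\<^esub> g) ` ?B" by blast
  qed
  then show "finite ?A" using nov_finite[OF b] finite_surj by blast
qed

lemma smult_translate:
  assumes h: "h \<in> carrier Gam" and b: "b \<in> carrier Nov" and x: "x \<in> carrier Ch"
  shows "nov_translate h b \<odot>\<^bsub>Ch\<^esub> x = translate h (b \<odot>\<^bsub>Ch\<^esub> x)"
proof (rule chain_eqI)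
  note hb = nov_translate_closed[OF h b]
  show "nov_translate h b \<odot>\<^bsub>Ch\<^esub> x \<in> carrier Ch" "translate h (b \<odot>\<^bsub>Ch\<^esub> x) \<in> carrier Ch"
    using hb b x h smult_closed translate_closed by auto
  fix q assume q: "q \<in> Pts"
  let ?m = "\<lambda>g. h \<otimes>\<^bsub>Gam\<^esub> g"
  let ?T = "terms_at b x (pull h q)"
  have inv: "inv\<^bsub>Gam\<^esub> h \<otimes>\<^bsub>Gam\<^esub> (h \<otimes>\<^bsub>Gam\<^esub> g) = g" "h \<otimes>\<^bsub>Gam\<^esub> (inv\<^bsub>Gam\<^esub> h \<otimes>\<^bsub>Gam\<^esub> g) = g" if "g \<in> carrier Gam" for g
    using h that by (simp_all add: Gam.m_assoc[symmetric])
  have T: "?T \<subseteq> carrier Gam" by (auto simp: terms_at_def)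
  have val: "nov_translate h b (?m g) = b g" "pull (?m g) q = pull g (pull h q)" if "g \<in> carrier Gam" for g
    using h that q by (auto simp: nov_translate_def inv pull_mult)
  have img: "terms_at (nov_translate h b) x q = ?m ` ?T"
  proof
    show "?m ` ?T \<subseteq> terms_at (nov_translate h b) x q"
      using h val by (auto simp: terms_at_def)
    show "terms_at (nov_translate h b) x q \<subseteq> ?m ` ?T"
    proof
      fix g assume g: "g \<in> terms_at (nov_translate h b) x q"
      let ?k = "inv\<^bsub>Gam\<^esub> h \<otimes>\<^bsub>Gam\<^esub> g"
      have k: "g \<in> carrier Gam" "?k \<in> carrier Gam" "?m ?k = g" using g h inv by (auto simp: terms_at_def)
      then have "?k \<in> ?T" using g val[of ?k] by (simp add: terms_at_def)
      then show "g \<in> ?m ` ?T" using k(3) by (metis imageI)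
    qed
  qed
  have inj: "inj_on ?m ?T" using h T by (auto intro!: inj_onI simp: subset_iff)
  have "(nov_translate h b \<odot>\<^bsub>Ch\<^esub> x) q = (\<Oplus>g\<in>?m ` ?T. nov_translate h b g \<otimes> x (pull g q))"
    by (simp add: smult_apply[OF q] img)
  also have "\<dots> = (\<Oplus>g\<in>?T. nov_translate h b (?m g) \<otimes> x (pull (?m g) q))"
    using T h term_closed[OF hb x q] by (intro finsum_reindex inj) auto
  also have "\<dots> = (\<Oplus>g\<in>?T. b g \<otimes> x (pull g (pull h q)))"
    using T val term_closed[OF b x pull_closed[OF h q]] by (intro finsum_cong') (auto simp: subset_iff)
  also have "\<dots> = translate h (b \<odot>\<^bsub>Ch\<^esub> x) q"
    using q h by (simp add: translate_apply smult_apply pull_closed)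
  finally show "(nov_translate h b \<odot>\<^bsub>Ch\<^esub> x) q = translate h (b \<odot>\<^bsub>Ch\<^esub> x) q" .
qed

definition nov_comb :: "('i \<Rightarrow> 'g \<Rightarrow> 'r) \<Rightarrow> ('i \<Rightarrow> 'p \<Rightarrow> 'r) \<Rightarrow> 'i set \<Rightarrow> 'p \<Rightarrow> 'r"
  where "nov_comb b u F = (\<Oplus>\<^bsub>Ch\<^esub>i\<in>F. b i \<odot>\<^bsub>Ch\<^esub> u i)"

lemma finsum_endo:
  assumes T: "T \<in> Ch.endos" and f: "\<And>i. i \<in> F \<Longrightarrow> f i \<in> carrier Ch"
  shows "T (\<Oplus>\<^bsub>Ch\<^esub>i\<in>F. f i) = (\<Oplus>\<^bsub>Ch\<^esub>i\<in>F. T (f i))"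
  using f
proof (induction F rule: infinite_finite_induct)
  case (insert i F)
  then have "f \<in> F \<rightarrow> carrier Ch" "(\<lambda>i. T (f i)) \<in> F \<rightarrow> carrier Ch" "f i \<in> carrier Ch"
    using Ch.endos_closed[OF T] by auto
  then show ?case using insert Ch.endos_closed[OF T]
    by (simp add: Ch.finsum_insert Ch.endos_add[OF T] Ch.finsum_closed)
qed (simp_all add: Ch.endos_zero[OF T] Ch.finsum_infinite)

lemma finsum_apply:
  assumes q: "q \<in> Pts" and f: "\<And>i. i \<in> F \<Longrightarrow> f i \<in> carrier Ch"
  shows "(\<Oplus>\<^bsub>Ch\<^esub>i\<in>F. f i) q = (\<Oplus>i\<in>F. f i q)"
  using f
proof (induction F rule: infinite_finite_induct)
  case (insert i F)
  then have "f \<in> F \<rightarrow> carrier Ch" "(\<lambda>i. f i q) \<in> F \<rightarrow> carrier R" "f i \<in> carrier Ch" "f i q \<in> carrier R"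
    using chain_coeff q by auto
  then show ?case using insert q
    by (simp add: Ch.finsum_insert finsum_insert Ch_add_apply)
qed (simp_all add: Ch_zero_apply q Ch.finsum_infinite finsum_infinite)

context
  fixes F :: "'i set" and u :: "'i \<Rightarrow> 'p \<Rightarrow> 'r"
  assumes u: "\<And>i. i \<in> F \<Longrightarrow> u i \<in> carrier Ch"
begin

lemma nov_comb_closed: "(\<And>i. i \<in> F \<Longrightarrow> b i \<in> carrier Nov) \<Longrightarrow> nov_comb b u F \<in> carrier Ch"
  unfolding nov_comb_def using u smult_closed by (intro Ch.finsum_closed) auto

lemma nov_comb_add:
  assumes "\<And>i. i \<in> F \<Longrightarrow> b i \<in> carrier Nov" "\<And>i. i \<in> F \<Longrightarrow> b' i \<in> carrier Nov"
  shows "nov_comb (\<lambda>i. b i \<oplus>\<^bsub>Nov\<^esub> b' i) u F = nov_comb b u F \<oplus>\<^bsub>Ch\<^esub> nov_comb b' u F"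
proof -
  have "nov_comb (\<lambda>i. b i \<oplus>\<^bsub>Nov\<^esub> b' i) u F = (\<Oplus>\<^bsub>Ch\<^esub>i\<in>F. b i \<odot>\<^bsub>Ch\<^esub> u i \<oplus>\<^bsub>Ch\<^esub> b' i \<odot>\<^bsub>Ch\<^esub> u i)"
    unfolding nov_comb_def using assms u smult_closed by (intro Ch.finsum_cong') (auto simp: smult_add)
  also have "\<dots> = nov_comb b u F \<oplus>\<^bsub>Ch\<^esub> nov_comb b' u F"
    unfolding nov_comb_def using assms u smult_closed by (intro Ch.finsum_addf) auto
  finally show ?thesis .
qed

lemma nov_comb_zero: "nov_comb (\<lambda>i. \<lambda>g\<in>carrier Gam. \<zero>) u F = \<zero>\<^bsub>Ch\<^esub>"
proof -
  have "nov_comb (\<lambda>i. \<lambda>g\<in>carrier Gam. \<zero>) u F = (\<Oplus>\<^bsub>Ch\<^esub>i\<in>F. \<zero>\<^bsub>Ch\<^esub>)"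
    unfolding nov_comb_def using u by (intro Ch.finsum_cong') (auto simp: smult_zero Ch_zero_closed)
  then show ?thesis by (simp add: Ch.finsum_zero)
qed

lemma nov_comb_endo:
  assumes T: "T \<in> Ch.endos" and b: "\<And>i. i \<in> F \<Longrightarrow> b i \<in> carrier Nov"
    and eq: "\<And>i. i \<in> F \<Longrightarrow> T (b i \<odot>\<^bsub>Ch\<^esub> u i) = b' i \<odot>\<^bsub>Ch\<^esub> u' i"
  shows "T (nov_comb b u F) = nov_comb b' u' F"
proof -
  have "T (nov_comb b u F) = (\<Oplus>\<^bsub>Ch\<^esub>i\<in>F. T (b i \<odot>\<^bsub>Ch\<^esub> u i))"
    unfolding nov_comb_def using b u smult_closed by (intro finsum_endo[OF T]) auto
  also have "\<dots> = nov_comb b' u' F"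
    unfolding nov_comb_def using b u smult_closed Ch.endos_closed[OF T] eq[symmetric]
    by (intro Ch.finsum_cong') auto
  finally show ?thesis .
qed

lemma nov_comb_zero_at:
  assumes q: "q \<in> Pts" and b: "\<And>i. i \<in> F \<Longrightarrow> b i \<in> carrier Nov"
    and z: "\<And>i g. i \<in> F \<Longrightarrow> g \<in> carrier Gam \<Longrightarrow> b i g \<noteq> \<zero> \<Longrightarrow> u i (pull g q) = \<zero>"
  shows "nov_comb b u F q = \<zero>"
proof -
  have "nov_comb b u F q = (\<Oplus>i\<in>F. (b i \<odot>\<^bsub>Ch\<^esub> u i) q)"
    unfolding nov_comb_def using b u smult_closed by (intro finsum_apply[OF q]) auto
  also have "\<dots> = (\<Oplus>i\<in>F. \<zero>)"
  proof (rule finsum_cong')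
    show "(b i \<odot>\<^bsub>Ch\<^esub> u i) q = \<zero>" if "i \<in> F" for i
      using z[OF that] by (intro smult_zero_at[OF q])
  qed auto
  finally show ?thesis by (simp add: finsum_zero)
qed

lemma nov_comb_mem:
  assumes U: "Ch.op_subgroup {} U" and b: "\<And>i. i \<in> F \<Longrightarrow> b i \<odot>\<^bsub>Ch\<^esub> u i \<in> U"
  shows "nov_comb b u F \<in> U"
  unfolding nov_comb_def using b
proof (induction F rule: infinite_finite_induct)
  case (insert i F)
  then have "(\<lambda>i. b i \<odot>\<^bsub>Ch\<^esub> u i) \<in> F \<rightarrow> carrier Ch" "b i \<odot>\<^bsub>Ch\<^esub> u i \<in> carrier Ch"
    using Ch.op_subgroupD(1)[OF U] by auto
  then show ?case using insert Ch.op_subgroup_add[OF U] by (simp add: Ch.finsum_insert)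
qed (simp_all add: Ch.finsum_infinite Ch.op_subgroupD(2)[OF U])

end

text \<open>
Each step in building a span over the ring \<open>R\<close> and the translations is matched by an operation on
Novikov coefficients.
\<close>

lemma op_span_nov_comb:
  assumes F: "finite F" "F \<subseteq> carrier Ch" and S: "S \<subseteq> carrier Gam" and y: "y \<in> Ch.op_span (ops S) F"
  shows "\<exists>b. (\<forall>i\<in>F. b i \<in> carrier Nov) \<and> y = nov_comb b (\<lambda>i. i) F"
proof -
  have u: "\<And>i. i \<in> F \<Longrightarrow> i \<in> carrier Ch" using F(2) by auto
  show ?thesis
    using y
  proof (induction rule: Ch.op_span.induct)
    case zero
    show ?case using nov_comb_zero[of F "\<lambda>i. i", OF u] nov_zero by metis
  next
    case (gen x)
    let ?b = "\<lambda>i. if i = x then nov_one else (\<lambda>g\<in>carrier Gam. \<zero>)"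
    have "nov_comb ?b (\<lambda>i. i) F = (\<Oplus>\<^bsub>Ch\<^esub>i\<in>F. if x = i then i else \<zero>\<^bsub>Ch\<^esub>)"
      unfolding nov_comb_def using u
      by (intro Ch.finsum_cong') (auto simp: smult_zero smult_one Ch_zero_closed)
    also have "\<dots> = x" using Ch.finsum_singleton[OF gen F(1), of "\<lambda>i. i"] u by auto
    finally show ?case using nov_zero nov_one_closed by (intro exI[of _ ?b]) auto
  next
    case (diff x y)
    then obtain b b' where b: "\<And>i. i \<in> F \<Longrightarrow> b i \<in> carrier Nov" "x = nov_comb b (\<lambda>i. i) F"
      and b': "\<And>i. i \<in> F \<Longrightarrow> b' i \<in> carrier Nov" "y = nov_comb b' (\<lambda>i. i) F" by blast
    let ?n = "\<lambda>i. nov_scale (\<ominus> \<one>) (b' i)"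
    have n: "\<And>i. i \<in> F \<Longrightarrow> ?n i \<in> carrier Nov" using b' nov_scale_closed by auto
    have xy: "x \<in> carrier Ch" "y \<in> carrier Ch" using b b' nov_comb_closed[of F "\<lambda>i. i", OF u] by auto
    have "nov_comb (\<lambda>i. b i \<oplus>\<^bsub>Nov\<^esub> ?n i) (\<lambda>i. i) F = x \<oplus>\<^bsub>Ch\<^esub> nov_comb ?n (\<lambda>i. i) F"
      using nov_comb_add[of F "\<lambda>i. i", OF u b(1) n] b(2) by simp
    also have "nov_comb ?n (\<lambda>i. i) F = scale (\<ominus> \<one>) y"
      unfolding b'(2) using b'(1) u
      by (intro nov_comb_endo[symmetric] scale_endo smult_scale[symmetric]) auto
    also have "x \<oplus>\<^bsub>Ch\<^esub> scale (\<ominus> \<one>) y = x \<ominus>\<^bsub>Ch\<^esub> y"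
      using scale_minus[of \<zero> \<one> y] scale_zero scale_one xy by (simp add: a_minus_def)
    finally have "x \<ominus>\<^bsub>Ch\<^esub> y = nov_comb (\<lambda>i. b i \<oplus>\<^bsub>Nov\<^esub> ?n i) (\<lambda>i. i) F" by simp
    then show ?case using b(1) n nov_add_closed
      by (intro exI[of _ "\<lambda>i. b i \<oplus>\<^bsub>Nov\<^esub> ?n i"]) simp
  next
    case (oper T x)
    then obtain b where b': "\<forall>i\<in>F. b i \<in> carrier Nov" "x = nov_comb b (\<lambda>i. i) F" by auto
    then have b: "\<And>i. i \<in> F \<Longrightarrow> b i \<in> carrier Nov" "x = nov_comb b (\<lambda>i. i) F" by simp_all
    consider r where "r \<in> carrier R" "T = scale r" | g where "g \<in> carrier Gam" "T = translate g"
      using oper(1) S by (auto simp: ops_def)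
    then show ?case
    proof cases
      case 1
      have "T x = nov_comb (\<lambda>i. nov_scale r (b i)) (\<lambda>i. i) F"
        unfolding b(2) 1(2) using 1(1) b(1) u
        by (intro nov_comb_endo scale_endo smult_scale[symmetric]) auto
      then show ?thesis using nov_scale_closed[OF 1(1) b(1)]
        by (intro exI[of _ "\<lambda>i. nov_scale r (b i)"]) simp
    next
      case 2
      have "T x = nov_comb (\<lambda>i. nov_translate g (b i)) (\<lambda>i. i) F"
        unfolding b(2) 2(2) using 2(1) b(1) u
        by (intro nov_comb_endo translate_endo smult_translate[symmetric]) auto
      then show ?thesis using nov_translate_closed[OF 2(1) b(1)]
        by (intro exI[of _ "\<lambda>i. nov_translate g (b i)"]) simp
    qed
  qed
qed

section \<open>Best representatives modulo a submodule\<close>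

lemma below_mono: "below s x \<Longrightarrow> s \<le> t \<Longrightarrow> below t x"
  unfolding below_def by force

lemma slice_idem: "slice t (slice t x) = slice t x"
  by (rule ext) (simp add: slice_def restrict_def)

text \<open>
A chain has only finitely many terms of action above \<open>t - 1\<close>, so that there is room below \<open>t\<close>.
\<close>

lemma leading_gap:
  assumes x: "x \<in> carrier Ch"
  shows "\<exists>\<delta>>0. \<forall>q\<in>Pts. t - \<delta> < action c q \<longrightarrow> action c q < t \<longrightarrow> x q = \<zero>"
proof -
  let ?S = "(\<lambda>q. t - action c q) ` {q \<in> {q \<in> Pts. x q \<noteq> \<zero> \<and> action c q > t - 1}. action c q < t}"
  have "finite {q \<in> {q \<in> Pts. x q \<noteq> \<zero> \<and> action c q > t - 1}. action c q < t}"
    using chain_finite[OF x, of "t - 1"] by (rule rev_finite_subset) blast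
  then have fin: "finite (insert 1 ?S)" by blast
  show ?thesis
  proof (intro exI[of _ "Min (insert 1 ?S)"] conjI ballI impI)
    show "0 < Min (insert 1 ?S)" using fin by auto
    fix q assume q: "q \<in> Pts" "t - Min (insert 1 ?S) < action c q" "action c q < t"
    show "x q = \<zero>"
    proof (rule ccontr)
      assume "x q \<noteq> \<zero>"
      moreover have "Min (insert 1 ?S) \<le> 1" using fin by (intro Min_le) auto
      ultimately have "t - action c q \<in> ?S" using q by auto
      then have "Min (insert 1 ?S) \<le> t - action c q" using fin by (intro Min_le) auto
      then show False using q by simp
    qed
  qed
qed

text \<open>
The leading slices of elements of \<open>U\<close> are finite chains, so finitely many of them span the rest.
Each \<open>m\<close> in \<open>F\<close> comes with a lift \<open>v m\<close> in \<open>U\<close>, whose leading slice at action \<open>\<tau> m\<close> is \<open>m\<close>.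
\<close>

lemma finitely_many_leading_slices:
  assumes U: "U \<subseteq> carrier Ch"
  shows "\<exists>F \<tau> v. finite F \<and>
    (\<forall>m\<in>F. v m \<in> U \<and> below (\<tau> m) (v m) \<and> slice (\<tau> m) (v m) = m) \<and>
    (\<forall>u\<in>U. \<forall>t. below t u \<longrightarrow>
      (\<exists>b. (\<forall>m\<in>F. b m \<in> carrier Nov) \<and> slice t u = nov_comb b (\<lambda>m. m) F))"
proof -
  let ?M = "{slice t u | t u. u \<in> U \<and> below t u}"
  obtain S V where S: "S \<subseteq> carrier Gam"
    and V: "Ch.op_subgroup (ops S) V" "Ch.op_noetherian (ops S) V"
      "{x \<in> carrier Ch. finite {q \<in> Pts. x q \<noteq> \<zero>}} \<subseteq> V"
    using finite_chains_noetherian by blast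
  have "?M \<subseteq> V"
  proof
    fix m assume "m \<in> ?M"
    then obtain t u where m: "m = slice t u" "u \<in> U" by blast
    then have u: "u \<in> carrier Ch" using U by blast
    have "{q \<in> Pts. slice t u q \<noteq> \<zero>} \<subseteq> {q \<in> Pts. u q \<noteq> \<zero> \<and> action c q > t - 1}"
      by (auto simp: slice_apply split: if_splits)
    then have "finite {q \<in> Pts. slice t u q \<noteq> \<zero>}"
      using chain_finite[OF u] finite_subset by blast
    then show "m \<in> V" using V(3) slice_closed[OF u] m(1) by blast
  qed
  from Ch.op_noetherian_subset_finite[OF ops_endos[OF S] V(1,2) this]
  obtain F where F: "finite F" "F \<subseteq> ?M" "?M \<subseteq> Ch.op_span (ops S) F" by blast
  have FC: "F \<subseteq> carrier Ch" using F(2) U slice_closed by blast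
  have "\<exists>b. (\<forall>m\<in>F. b m \<in> carrier Nov) \<and> slice t u = nov_comb b (\<lambda>m. m) F"
    if "u \<in> U" "below t u" for u t
  proof -
    have "slice t u \<in> Ch.op_span (ops S) F" using F(3) that by blast
    then show ?thesis by (rule op_span_nov_comb[OF F(1) FC S])
  qed
  moreover have "\<forall>m\<in>F. \<exists>p. snd p \<in> U \<and> below (fst p) (snd p) \<and> slice (fst p) (snd p) = m"
    using F(2) by fastforce
  from bchoice[OF this] obtain p where
    "\<forall>m\<in>F. snd (p m) \<in> U \<and> below (fst (p m)) (snd (p m)) \<and> slice (fst (p m)) (snd (p m)) = m" ..
  ultimately show ?thesis using F(1)
    by (intro exI[of _ F] exI[of _ "\<lambda>m. fst (p m)"] exI[of _ "\<lambda>m. snd (p m)"]) simp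
qed

text \<open>
Multiplication by \<open>g\<close> moves action \<open>\<tau>\<close> to action \<open>\<tau> - period c g\<close>.  So only the coefficients of
period \<open>\<tau> - t\<close> contribute to the slice at \<open>t\<close> of a multiple of a chain concentrated at action \<open>\<tau>\<close>;
discarding the others makes the same slice appear for the whole chain \<open>v\<close>.
\<close>

lemma lift_leading_slice:
  fixes t \<tau> :: real
  assumes b: "b \<in> carrier Nov" and v: "v \<in> carrier Ch"
  defines "b' \<equiv> \<lambda>g\<in>carrier Gam. if period c g = \<tau> - t then b g else \<zero>"
  shows "b' \<in> carrier Nov" "slice t (b' \<odot>\<^bsub>Ch\<^esub> v) = slice t (b \<odot>\<^bsub>Ch\<^esub> slice \<tau> v)"
proof -
  show b': "b' \<in> carrier Nov"
    by (rule nov_mono_support[OF b]) (auto simp: b'_def nov_coeff[OF b])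
  note sv = slice_closed[OF v]
  show "slice t (b' \<odot>\<^bsub>Ch\<^esub> v) = slice t (b \<odot>\<^bsub>Ch\<^esub> slice \<tau> v)"
  proof (rule chain_eqI)
    show "slice t (b' \<odot>\<^bsub>Ch\<^esub> v) \<in> carrier Ch" "slice t (b \<odot>\<^bsub>Ch\<^esub> slice \<tau> v) \<in> carrier Ch"
      using slice_closed smult_closed b b' v sv by auto
    fix q assume q: "q \<in> Pts"
    show "slice t (b' \<odot>\<^bsub>Ch\<^esub> v) q = slice t (b \<odot>\<^bsub>Ch\<^esub> slice \<tau> v) q"
    proof (cases "action c q = t")
      case True
      have act: "action c (pull g q) = t + period c g" if "g \<in> carrier Gam" for g
        using action_pull[OF that q] True by simp
      have eq: "terms_at b' v q = terms_at b (slice \<tau> v) q"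
        using act q pull_closed by (auto simp: terms_at_def b'_def slice_apply split: if_splits)
      have "(b' \<odot>\<^bsub>Ch\<^esub> v) q = (b \<odot>\<^bsub>Ch\<^esub> slice \<tau> v) q"
        unfolding smult_apply[OF q] eq
      proof (rule finsum_cong')
        show "(\<lambda>g. b g \<otimes> slice \<tau> v (pull g q)) \<in> terms_at b (slice \<tau> v) q \<rightarrow> carrier R"
          using term_closed[OF b sv q] by (auto simp: terms_at_def)
        fix g assume g: "g \<in> terms_at b (slice \<tau> v) q"
        then have gG: "g \<in> carrier Gam" by (simp add: terms_at_def)
        then have "period c g = \<tau> - t"
          using g act q pull_closed by (auto simp: terms_at_def slice_apply split: if_splits)
        then show "b' g \<otimes> v (pull g q) = b g \<otimes> slice \<tau> v (pull g q)"
          using gG act[OF gG] pull_closed[OF gG q] by (simp add: b'_def slice_apply)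
      qed simp
      then show ?thesis using q True by (simp add: slice_apply)
    next
      case False
      then show ?thesis using q by (simp add: slice_apply)
    qed
  qed
qed

lemma diff_add_diff:
  assumes "x \<in> carrier Ch" "y \<in> carrier Ch" "w \<in> carrier Ch"
  shows "x \<ominus>\<^bsub>Ch\<^esub> (y \<ominus>\<^bsub>Ch\<^esub> w) = (x \<ominus>\<^bsub>Ch\<^esub> y) \<oplus>\<^bsub>Ch\<^esub> w"
    "x \<ominus>\<^bsub>Ch\<^esub> (y \<oplus>\<^bsub>Ch\<^esub> w) = (x \<ominus>\<^bsub>Ch\<^esub> y) \<ominus>\<^bsub>Ch\<^esub> w"
    "x \<ominus>\<^bsub>Ch\<^esub> (x \<ominus>\<^bsub>Ch\<^esub> w) = w"
  using assms by (simp_all add: Ch.minus_eq Ch.minus_add Ch.a_assoc Ch.r_neg2)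

context
  fixes U :: "('p \<Rightarrow> 'r) set"
  assumes U: "Ch.op_subgroup {} U"
    and smult_U: "\<And>b u. b \<in> carrier Nov \<Longrightarrow> u \<in> U \<Longrightarrow> b \<odot>\<^bsub>Ch\<^esub> u \<in> U"
begin

text \<open>
The chain \<open>x\<close> is written as a Novikov combination of the lifts \<open>v m\<close> by infinitely many
reductions.  A step removes the part of a chain at one level \<open>s\<close>; by the choice of \<open>\<delta>\<close> this does not
disturb actions strictly between \<open>s - \<delta>\<close> and \<open>s\<close>.  Finitely many steps clear a whole window of
width \<open>\<delta>\<close>, and clearing consecutive windows gives approximations \<open>\<mu> n\<close> of the coefficients
whose limit is \<open>lam\<close>.
\<close>

lemma reducible_imp_mem:
  assumes x: "x \<in> carrier Ch"
    and reducible: "\<And>y s. y \<in> carrier Ch \<Longrightarrow> x \<ominus>\<^bsub>Ch\<^esub> y \<in> U \<Longrightarrow> below s y \<Longrightarrow>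
      \<exists>u\<in>U. below s u \<and> slice s u = slice s y"
  shows "x \<in> U"
proof -
  note UC = Ch.op_subgroupD(1)[OF U, THEN subsetD]
  obtain F \<tau> v where F: "finite F"
    and lift: "\<forall>m\<in>F. v m \<in> U \<and> below (\<tau> m) (v m) \<and> slice (\<tau> m) (v m) = m"
    and Fgen: "\<forall>u\<in>U. \<forall>t. below t u \<longrightarrow>
      (\<exists>b. (\<forall>m\<in>F. b m \<in> carrier Nov) \<and> slice t u = nov_comb b (\<lambda>m. m) F)"
    using finitely_many_leading_slices[OF Ch.op_subgroupD(1)[OF U]] by (elim exE conjE)
  have vU: "v m \<in> U" and vb: "below (\<tau> m) (v m)" and vm: "slice (\<tau> m) (v m) = m" if "m \<in> F" for m
    using lift that by simp_all
  have v: "v m \<in> carrier Ch" if "m \<in> F" for m using UC[OF vU[OF that]] .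
  have FC: "m \<in> carrier Ch" if "m \<in> F" for m using slice_closed[OF v[OF that]] vm[OF that] by metis
  have combU: "nov_comb b v F \<in> U" if "\<And>m. m \<in> F \<Longrightarrow> b m \<in> carrier Nov" for b
    using that vU smult_U by (intro nov_comb_mem[OF v U]) auto
  have combC: "nov_comb b v F \<in> carrier Ch" if "\<And>m. m \<in> F \<Longrightarrow> b m \<in> carrier Nov" for b
    using that by (intro nov_comb_closed v)
  have "\<forall>m\<in>F. \<exists>\<delta>>0. \<forall>q\<in>Pts. \<tau> m - \<delta> < action c q \<longrightarrow> action c q < \<tau> m \<longrightarrow> v m q = \<zero>"
    using leading_gap[OF v] by simp
  from bchoice[OF this] obtain d where d0: "\<forall>m\<in>F. d m > 0 \<and>
      (\<forall>q\<in>Pts. \<tau> m - d m < action c q \<longrightarrow> action c q < \<tau> m \<longrightarrow> v m q = \<zero>)" ..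
  then have d: "\<And>m. m \<in> F \<Longrightarrow> d m > 0"
    "\<And>m q. m \<in> F \<Longrightarrow> q \<in> Pts \<Longrightarrow> \<tau> m - d m < action c q \<Longrightarrow> action c q < \<tau> m \<Longrightarrow> v m q = \<zero>"
    by simp_all
  define \<delta> where "\<delta> = Min (insert 1 (d ` F))"
  have \<delta>: "\<delta> > 0" unfolding \<delta>_def using F d(1) by auto
  have \<delta>_le: "\<delta> \<le> d m" if "m \<in> F" for m unfolding \<delta>_def using F that by (intro Min_le) auto
  have gap: "v m q = \<zero>" if "m \<in> F" "q \<in> Pts" "\<tau> m - \<delta> < action c q" "action c q < \<tau> m" for m q
    using d(2)[OF that(1,2)] \<delta>_le[OF that(1)] that(3,4) by simp

  \<comment> \<open>Cancel the slice at \<open>s\<close> by lifting an expression of it in the generators.\<close>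
  have step: "\<exists>b. (\<forall>m\<in>F. b m \<in> carrier Nov \<and> (\<forall>g\<in>carrier Gam. b m g \<noteq> \<zero> \<longrightarrow> period c g = \<tau> m - s)) \<and>
      (\<forall>q\<in>Pts. (action c q \<ge> s \<longrightarrow> (y \<ominus>\<^bsub>Ch\<^esub> nov_comb b v F) q = \<zero>) \<and>
        (s - \<delta> < action c q \<longrightarrow> action c q < s \<longrightarrow> (y \<ominus>\<^bsub>Ch\<^esub> nov_comb b v F) q = y q))"
    if y: "y \<in> carrier Ch" "x \<ominus>\<^bsub>Ch\<^esub> y \<in> U" "below s y" for y s
  proof -
    obtain u where u: "u \<in> U" "below s u" "slice s u = slice s y" using reducible[OF y] by blast
    obtain b0 where b0: "\<forall>m\<in>F. b0 m \<in> carrier Nov" "slice s u = nov_comb b0 (\<lambda>m. m) F" using Fgen[rule_format, OF u(1,2)] by blast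
    define b where "b m = (\<lambda>g\<in>carrier Gam. if period c g = \<tau> m - s then b0 m g else \<zero>)" for m
    have b: "b m \<in> carrier Nov" if "m \<in> F" for m
      unfolding b_def using lift_leading_slice(1) b0(1) v that by blast
    have per: "period c g = \<tau> m - s" if "m \<in> F" "g \<in> carrier Gam" "b m g \<noteq> \<zero>" for m g
      using that by (auto simp: b_def split: if_splits)
    have w: "nov_comb b v F \<in> carrier Ch" using combC b by blast
    have "slice s (nov_comb b v F) = (\<Oplus>\<^bsub>Ch\<^esub>m\<in>F. slice s (b m \<odot>\<^bsub>Ch\<^esub> v m))"
      unfolding nov_comb_def using b v smult_closed by (intro finsum_endo[OF slice_endo]) auto
    also have "\<dots> = (\<Oplus>\<^bsub>Ch\<^esub>m\<in>F. slice s (b0 m \<odot>\<^bsub>Ch\<^esub> m))"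
    proof (rule Ch.finsum_cong')
      fix m assume m: "m \<in> F"
      show "slice s (b m \<odot>\<^bsub>Ch\<^esub> v m) = slice s (b0 m \<odot>\<^bsub>Ch\<^esub> m)"
        using lift_leading_slice(2)[OF b0(1)[rule_format, OF m] v[OF m], of s "\<tau> m"]
        unfolding b_def vm[OF m] .
    qed (use b0(1) FC smult_closed slice_closed in auto)
    also have "\<dots> = slice s (nov_comb b0 (\<lambda>m. m) F)"
      unfolding nov_comb_def using b0(1) FC smult_closed by (intro finsum_endo[OF slice_endo, symmetric]) auto
    also have "\<dots> = slice s y" using b0(2) u(3) slice_idem by metis
    finally have sl: "slice s (nov_comb b v F) = slice s y" .
    have top: "(y \<ominus>\<^bsub>Ch\<^esub> nov_comb b v F) q = \<zero>" if q: "q \<in> Pts" "action c q \<ge> s" for q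
    proof -
      have "nov_comb b v F q = y q"
      proof (cases "action c q = s")
        case True
        then show ?thesis using fun_cong[OF sl, of q] q by (simp add: slice_apply)
      next
        case False
        then have "action c q > s" using q(2) by simp
        then have "nov_comb b v F q = \<zero>"
        proof (intro nov_comb_zero_at[OF v q(1) b])
          fix m g assume m: "m \<in> F" "g \<in> carrier Gam" "b m g \<noteq> \<zero>"
          then have "action c (pull g q) > \<tau> m"
            using per[OF m] action_pull[OF m(2) q(1)] \<open>action c q > s\<close> by simp
          then show "v m (pull g q) = \<zero>"
            using vb[OF m(1)] pull_closed[OF m(2) q(1)] by (simp add: below_def)
        qed
        moreover have "y q = \<zero>" using y(3) q(1) \<open>action c q > s\<close> by (simp add: below_def)
        ultimately show ?thesis by simp
      qed
      then show ?thesis using Ch_minus_apply[OF y(1) w q(1)] chain_coeff[OF y(1) q(1)]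
        by (simp add: a_minus_def r_neg)
    qed
    have low: "(y \<ominus>\<^bsub>Ch\<^esub> nov_comb b v F) q = y q" if q: "q \<in> Pts" "s - \<delta> < action c q" "action c q < s" for q
    proof -
      have "nov_comb b v F q = \<zero>"
      proof (intro nov_comb_zero_at[OF v q(1) b])
        fix m g assume m: "m \<in> F" "g \<in> carrier Gam" "b m g \<noteq> \<zero>"
        then have "\<tau> m - \<delta> < action c (pull g q)" "action c (pull g q) < \<tau> m"
          using per[OF m] action_pull[OF m(2) q(1)] q by simp_all
        then show "v m (pull g q) = \<zero>"
          using gap[OF m(1) pull_closed[OF m(2) q(1)]] by simp
      qed
      then show ?thesis using Ch_minus_apply[OF y(1) w q(1)] chain_coeff[OF y(1) q(1)]
        by (simp add: a_minus_def)
    qed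
    show ?thesis using b per top low by (intro exI[of _ b]) simp
  qed

  \<comment> \<open>The step at the top action of \<open>y\<close> removes one action above \<open>\<theta>\<close> and adds none, as \<open>s - \<delta> \<le> \<theta>\<close>.\<close>
  have window: "\<exists>b. (\<forall>m\<in>F. b m \<in> carrier Nov \<and> (\<forall>g\<in>carrier Gam. b m g \<noteq> \<zero> \<longrightarrow>
        \<theta> < \<tau> m - period c g \<and> \<tau> m - period c g \<le> \<theta> + \<delta>)) \<and>
      below \<theta> (y \<ominus>\<^bsub>Ch\<^esub> nov_comb b v F)"
    if "y \<in> carrier Ch" "x \<ominus>\<^bsub>Ch\<^esub> y \<in> U" "below (\<theta> + \<delta>) y" for y \<theta>
    using that
  proof (induction "card (action c ` {q \<in> Pts. y q \<noteq> \<zero> \<and> action c q > \<theta>})" arbitrary: y rule: less_induct)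
    case less
    let ?A = "\<lambda>y. action c ` {q \<in> Pts. y q \<noteq> \<zero> \<and> action c q > \<theta>}"
    have fin: "finite (?A y)" using chain_finite[OF less.prems(1)] by blast
    show ?case
    proof (cases "?A y = {}")
      case True
      have "y \<ominus>\<^bsub>Ch\<^esub> \<zero>\<^bsub>Ch\<^esub> = y" using less.prems(1) by (simp add: Ch.minus_eq)
      then have "below \<theta> (y \<ominus>\<^bsub>Ch\<^esub> nov_comb (\<lambda>m. \<lambda>g\<in>carrier Gam. \<zero>) v F)"
        using True nov_comb_zero[of F v, OF v] by (auto simp: below_def)
      then show ?thesis using nov_zero by (intro exI[of _ "\<lambda>m. \<lambda>g\<in>carrier Gam. \<zero>"]) simp
    next
      case False
      define s where "s = Max (?A y)"
      have sA: "s \<in> ?A y" unfolding s_def using fin False by (rule Max_in)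
      then obtain q0 where q0: "q0 \<in> Pts" "y q0 \<noteq> \<zero>" "action c q0 > \<theta>" "action c q0 = s" by auto
      have s1: "\<theta> < s" using q0 by simp
      have s2: "s \<le> \<theta> + \<delta>" using less.prems(3) q0 unfolding below_def by force
      have ys: "below s y"
        unfolding below_def
      proof (intro ballI impI, rule ccontr)
        fix q assume "q \<in> Pts" "action c q > s" "y q \<noteq> \<zero>"
        then have "action c q \<in> ?A y" using s1 by auto
        then have "action c q \<le> s" unfolding s_def using fin by (rule Max_ge[rotated])
        then show False using \<open>action c q > s\<close> by simp
      qed
      obtain b1 where b1: "\<forall>m\<in>F. b1 m \<in> carrier Nov \<and> (\<forall>g\<in>carrier Gam. b1 m g \<noteq> \<zero> \<longrightarrow> period c g = \<tau> m - s)"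
        and z0: "\<forall>q\<in>Pts. (action c q \<ge> s \<longrightarrow> (y \<ominus>\<^bsub>Ch\<^esub> nov_comb b1 v F) q = \<zero>) \<and>
          (s - \<delta> < action c q \<longrightarrow> action c q < s \<longrightarrow> (y \<ominus>\<^bsub>Ch\<^esub> nov_comb b1 v F) q = y q)"
        using step[OF less.prems(1,2) ys] by blast
      define z where "z = y \<ominus>\<^bsub>Ch\<^esub> nov_comb b1 v F"
      have w: "nov_comb b1 v F \<in> U" "nov_comb b1 v F \<in> carrier Ch" using combU combC b1 by auto
      have z: "z \<in> carrier Ch" using w less.prems(1) by (simp add: z_def)
      have zU: "x \<ominus>\<^bsub>Ch\<^esub> z \<in> U"
        unfolding z_def diff_add_diff(1)[OF x less.prems(1) w(2)]
        using Ch.op_subgroup_add[OF U less.prems(2) w(1)] .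
      have zb: "below (\<theta> + \<delta>) z" using z0 s2 unfolding below_def z_def by fastforce
      have "?A z \<subseteq> ?A y - {s}"
      proof
        fix a assume "a \<in> ?A z"
        then obtain q where q: "q \<in> Pts" "z q \<noteq> \<zero>" "action c q > \<theta>" "a = action c q" by auto
        then have "action c q < s" using z0 unfolding z_def by force
        moreover then have "z q = y q" using z0 q s2 unfolding z_def by force
        ultimately show "a \<in> ?A y - {s}" using q by auto
      qed
      then have "?A z \<subset> ?A y" using sA by blast
      then have "card (?A z) < card (?A y)" using fin by (rule psubset_card_mono[rotated])
      from less.hyps[OF this z zU zb]
      obtain b2 where b2: "\<forall>m\<in>F. b2 m \<in> carrier Nov \<and> (\<forall>g\<in>carrier Gam. b2 m g \<noteq> \<zero> \<longrightarrow>
          \<theta> < \<tau> m - period c g \<and> \<tau> m - period c g \<le> \<theta> + \<delta>)"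
        "below \<theta> (z \<ominus>\<^bsub>Ch\<^esub> nov_comb b2 v F)" by blast
      have nov: "\<And>m. m \<in> F \<Longrightarrow> b1 m \<in> carrier Nov" "\<And>m. m \<in> F \<Longrightarrow> b2 m \<in> carrier Nov" using b1 b2(1) by auto
      have sum: "nov_comb (\<lambda>m. b1 m \<oplus>\<^bsub>Nov\<^esub> b2 m) v F = nov_comb b1 v F \<oplus>\<^bsub>Ch\<^esub> nov_comb b2 v F"
        using nov by (intro nov_comb_add v)
      have w2: "nov_comb b2 v F \<in> carrier Ch" using combC nov(2) by simp
      have "y \<ominus>\<^bsub>Ch\<^esub> nov_comb (\<lambda>m. b1 m \<oplus>\<^bsub>Nov\<^esub> b2 m) v F = z \<ominus>\<^bsub>Ch\<^esub> nov_comb b2 v F"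
        unfolding sum z_def by (rule diff_add_diff(2)[OF less.prems(1) w(2) w2])
      moreover have "\<theta> < \<tau> m - period c g \<and> \<tau> m - period c g \<le> \<theta> + \<delta>"
        if "m \<in> F" "g \<in> carrier Gam" "(b1 m \<oplus>\<^bsub>Nov\<^esub> b2 m) g \<noteq> \<zero>" for m g
      proof (cases "b1 m g = \<zero>")
        case True
        then have "b2 m g \<noteq> \<zero>" using that(2,3) by (auto simp: nov_add)
        then show ?thesis using b2(1) that by blast
      next
        case False
        then have "period c g = \<tau> m - s" using b1 that by blast
        then show ?thesis using s1 s2 by simp
      qed
      ultimately show ?thesis using b2(2) nov nov_add_closed
        by (intro exI[of _ "\<lambda>m. b1 m \<oplus>\<^bsub>Nov\<^esub> b2 m"]) simp
    qed
  qed

  obtain t0 where t0: "below t0 x" using chain_bounded[OF x] by blast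
  define \<theta> where "\<theta> n = t0 - real n * \<delta>" for n :: nat
  have \<theta>_Suc: "\<theta> (Suc n) + \<delta> = \<theta> n" for n by (simp add: \<theta>_def algebra_simps)
  have \<theta>_anti: "\<theta> k \<le> \<theta> n" if "n \<le> k" for n k using that \<delta> by (simp add: \<theta>_def)
  have \<theta>_unbounded: "\<exists>n. \<theta> n < r" for r
  proof -
    obtain n where "(t0 - r) / \<delta> < real n" using reals_Archimedean2 by blast
    then have "t0 - r < real n * \<delta>" using \<delta> by (simp add: pos_divide_less_eq)
    then show ?thesis by (intro exI[of _ n]) (simp add: \<theta>_def)
  qed
  \<comment> \<open>The coefficients used for level \<open>t\<close> have \<open>\<tau> m - period c g = t\<close>, so passing to the next window changes none of the earlier coefficients.\<close>
  define good where "good n \<mu> \<longleftrightarrow> (\<forall>m\<in>F. \<mu> m \<in> carrier Nov \<and>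
      (\<forall>g\<in>carrier Gam. \<mu> m g \<noteq> \<zero> \<longrightarrow> \<theta> n < \<tau> m - period c g)) \<and> below (\<theta> n) (x \<ominus>\<^bsub>Ch\<^esub> nov_comb \<mu> v F)"
    for n :: nat and \<mu>
  define extends where "extends n \<mu> \<mu>' \<longleftrightarrow> (\<forall>m\<in>F. \<forall>g\<in>carrier Gam. \<theta> n < \<tau> m - period c g \<longrightarrow> \<mu>' m g = \<mu> m g)"
    for n :: nat and \<mu> \<mu>' :: "('p \<Rightarrow> 'r) \<Rightarrow> 'g \<Rightarrow> 'r"
  have "\<exists>\<mu>. \<forall>n. good n (\<mu> n) \<and> extends n (\<mu> n) (\<mu> (Suc n))"
  proof (rule dependent_nat_choice)
    have "x \<ominus>\<^bsub>Ch\<^esub> nov_comb (\<lambda>m. \<lambda>g\<in>carrier Gam. \<zero>) v F = x"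
      using nov_comb_zero[of F v, OF v] x by (simp add: Ch.minus_eq)
    then show "\<exists>\<mu>. good 0 \<mu>"
      using nov_zero t0 by (intro exI[of _ "\<lambda>m. \<lambda>g\<in>carrier Gam. \<zero>"]) (simp add: good_def \<theta>_def)
    fix \<mu> n assume \<mu>: "good n \<mu>"
    then have nov: "\<And>m. m \<in> F \<Longrightarrow> \<mu> m \<in> carrier Nov" by (simp add: good_def)
    let ?y = "x \<ominus>\<^bsub>Ch\<^esub> nov_comb \<mu> v F"
    have w: "nov_comb \<mu> v F \<in> U" "nov_comb \<mu> v F \<in> carrier Ch" using combU combC nov by auto
    have y: "?y \<in> carrier Ch" using x w by simp
    have yU: "x \<ominus>\<^bsub>Ch\<^esub> ?y \<in> U" using diff_add_diff(3)[OF x x w(2)] w(1) by simp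
    have yb: "below (\<theta> (Suc n) + \<delta>) ?y" using \<mu> \<theta>_Suc by (simp add: good_def)
    obtain b where b: "\<forall>m\<in>F. b m \<in> carrier Nov \<and> (\<forall>g\<in>carrier Gam. b m g \<noteq> \<zero> \<longrightarrow>
        \<theta> (Suc n) < \<tau> m - period c g \<and> \<tau> m - period c g \<le> \<theta> (Suc n) + \<delta>)"
      "below (\<theta> (Suc n)) (?y \<ominus>\<^bsub>Ch\<^esub> nov_comb b v F)"
      using window[OF y yU yb] by blast
    have bnov: "\<And>m. m \<in> F \<Longrightarrow> b m \<in> carrier Nov" using b(1) by simp
    let ?\<mu> = "\<lambda>m. \<mu> m \<oplus>\<^bsub>Nov\<^esub> b m"
    have sum: "nov_comb ?\<mu> v F = nov_comb \<mu> v F \<oplus>\<^bsub>Ch\<^esub> nov_comb b v F"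
      using nov bnov by (intro nov_comb_add v)
    have wb: "nov_comb b v F \<in> carrier Ch" using combC bnov by simp
    have eq: "x \<ominus>\<^bsub>Ch\<^esub> nov_comb ?\<mu> v F = ?y \<ominus>\<^bsub>Ch\<^esub> nov_comb b v F"
      unfolding sum by (rule diff_add_diff(2)[OF x w(2) wb])
    have "\<theta> (Suc n) < \<tau> m - period c g" if "m \<in> F" "g \<in> carrier Gam" "?\<mu> m g \<noteq> \<zero>" for m g
    proof (cases "b m g = \<zero>")
      case True
      then have "\<mu> m g \<noteq> \<zero>" using that(2,3) by (auto simp: nov_add)
      then have "\<theta> n < \<tau> m - period c g" using \<mu> that by (simp add: good_def)
      then show ?thesis using \<theta>_anti[of n "Suc n"] by simp
    next
      case False
      then show ?thesis using b(1) that by blast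
    qed
    then have "good (Suc n) ?\<mu>"
      unfolding good_def eq using b(2) nov bnov nov_add_closed by simp
    moreover have "extends n \<mu> ?\<mu>"
      unfolding extends_def
    proof (intro ballI impI)
      fix m g assume m: "m \<in> F" "g \<in> carrier Gam" "\<theta> n < \<tau> m - period c g"
      have "b m g = \<zero>"
      proof (rule ccontr)
        assume "b m g \<noteq> \<zero>"
        then have "\<tau> m - period c g \<le> \<theta> (Suc n) + \<delta>" using b(1) m by blast
        then show False using m(3) \<theta>_Suc by simp
      qed
      then show "?\<mu> m g = \<mu> m g" using m nov_coeff[OF nov[OF m(1)] m(2)] by (simp add: nov_add)
    qed
    ultimately show "\<exists>\<mu>'. good (Suc n) \<mu>' \<and> extends n \<mu> \<mu>'" by blast
  qed
  then obtain \<mu> where \<mu>: "\<And>n. good n (\<mu> n)" "\<And>n. extends n (\<mu> n) (\<mu> (Suc n))" by blast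
  have \<mu>_nov: "\<mu> n m \<in> carrier Nov" if "m \<in> F" for n m using \<mu>(1)[of n] that by (simp add: good_def)
  have stable: "\<mu> k m g = \<mu> n m g" if "n \<le> k" "m \<in> F" "g \<in> carrier Gam" "\<theta> n < \<tau> m - period c g" for n k m g
    using that(1)
  proof (induction k rule: dec_induct)
    case (step k)
    have "\<theta> k < \<tau> m - period c g" using \<theta>_anti[OF step(1)] that(4) by simp
    then show ?case using \<mu>(2)[of k] that step by (simp add: extends_def)
  qed simp
  \<comment> \<open>Each coefficient is constant from some window on; the limit takes its value there.\<close>
  define stage where "stage m g = (LEAST n. \<theta> n < \<tau> m - period c g)" for m g
  define lam where "lam m = (\<lambda>g\<in>carrier Gam. \<mu> (stage m g) m g)" for m
  have lim: "lam m g = \<mu> n m g" if "m \<in> F" "g \<in> carrier Gam" "\<theta> n < \<tau> m - period c g" for m g n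
  proof -
    have "\<theta> (stage m g) < \<tau> m - period c g" unfolding stage_def using that(3) by (rule LeastI)
    moreover have "stage m g \<le> n" unfolding stage_def using that(3) by (rule Least_le)
    ultimately show ?thesis using stable[of "stage m g" n m g] that by (simp add: lam_def)
  qed
  have lam_nov: "lam m \<in> carrier Nov" if m: "m \<in> F" for m
    unfolding nov_iff
  proof (intro conjI allI)
    show "lam m \<in> carrier Gam \<rightarrow>\<^sub>E carrier R" using nov_coeff[OF \<mu>_nov[OF m]] by (auto simp: lam_def)
    fix C
    obtain n where n: "\<theta> n < \<tau> m - C" using \<theta>_unbounded by blast
    have "{g \<in> carrier Gam. lam m g \<noteq> \<zero> \<and> period c g < C} \<subseteq> {g \<in> carrier Gam. \<mu> n m g \<noteq> \<zero> \<and> period c g < C}"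
      using lim[OF m, of _ n] n by auto
    then show "finite {g \<in> carrier Gam. lam m g \<noteq> \<zero> \<and> period c g < C}"
      using nov_finite[OF \<mu>_nov[OF m]] finite_subset by blast
  qed
  have "x = nov_comb lam v F"
  proof (rule chain_eqI[OF x])
    show "nov_comb lam v F \<in> carrier Ch" using combC lam_nov by simp
    fix q assume q: "q \<in> Pts"
    obtain n where n: "\<theta> n < action c q" using \<theta>_unbounded by blast
    \<comment> \<open>Coefficients beyond window \<open>n\<close> only affect actions at most \<open>\<theta> n\<close>, hence not the one of \<open>q\<close>.\<close>
    define rest where "rest m = (\<lambda>g\<in>carrier Gam. if \<theta> n < \<tau> m - period c g then \<zero> else lam m g)" for m
    have rest: "rest m \<in> carrier Nov" if "m \<in> F" for m
      by (rule nov_mono_support[OF lam_nov[OF that]]) (auto simp: rest_def nov_coeff[OF lam_nov[OF that]])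
    have split: "lam m = \<mu> n m \<oplus>\<^bsub>Nov\<^esub> rest m" if m: "m \<in> F" for m
    proof (rule PiE_ext)
      show "lam m \<in> carrier Gam \<rightarrow>\<^sub>E carrier R" "\<mu> n m \<oplus>\<^bsub>Nov\<^esub> rest m \<in> carrier Gam \<rightarrow>\<^sub>E carrier R"
        using lam_nov[OF m] nov_add_closed[OF \<mu>_nov[OF m] rest[OF m]] by (auto simp: nov_iff)
      fix g assume g: "g \<in> carrier Gam"
      show "lam m g = (\<mu> n m \<oplus>\<^bsub>Nov\<^esub> rest m) g"
      proof (cases "\<theta> n < \<tau> m - period c g")
        case True
        then show ?thesis using lim[OF m g True] g nov_coeff[OF \<mu>_nov[OF m] g] by (simp add: nov_add rest_def)
      next
        case False
        then have "\<mu> n m g = \<zero>" using \<mu>(1)[of n] m g unfolding good_def by blast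
        then show ?thesis using False g nov_coeff[OF lam_nov[OF m] g] by (simp add: nov_add rest_def)
      qed
    qed
    have "nov_comb lam v F = nov_comb (\<lambda>m. \<mu> n m \<oplus>\<^bsub>Nov\<^esub> rest m) v F"
      unfolding nov_comb_def using split \<mu>_nov rest nov_add_closed smult_closed v
      by (intro Ch.finsum_cong') auto
    also have "\<dots> = nov_comb (\<mu> n) v F \<oplus>\<^bsub>Ch\<^esub> nov_comb rest v F" using \<mu>_nov rest by (intro nov_comb_add v)
    finally have "nov_comb lam v F q = nov_comb (\<mu> n) v F q \<oplus> nov_comb rest v F q" using q by (simp add: Ch_add_apply)
    also have "nov_comb rest v F q = \<zero>"
    proof (intro nov_comb_zero_at[OF v q rest])
      fix m g assume m: "m \<in> F" "g \<in> carrier Gam" "rest m g \<noteq> \<zero>"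
      then have "\<not> \<theta> n < \<tau> m - period c g" by (auto simp: rest_def)
      then have "action c (pull g q) > \<tau> m" using action_pull[OF m(2) q] n by simp
      then show "v m (pull g q) = \<zero>" using vb[OF m(1)] pull_closed[OF m(2) q] by (simp add: below_def)
    qed
    also have "nov_comb (\<mu> n) v F q \<oplus> \<zero> = x q"
    proof -
      have w: "nov_comb (\<mu> n) v F \<in> carrier Ch" using combC \<mu>_nov by simp
      have "(x \<ominus>\<^bsub>Ch\<^esub> nov_comb (\<mu> n) v F) q = \<zero>" using \<mu>(1)[of n] n q by (simp add: good_def below_def)
      then have "x q \<ominus> nov_comb (\<mu> n) v F q = \<zero>" using Ch_minus_apply[OF x w q] by simp
      then show ?thesis using chain_coeff[OF x q] chain_coeff[OF w q] by (simp add: r_right_minus_eq)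
    qed
    finally show "x q = nov_comb lam v F q" by simp
  qed
  then show "x \<in> U" using combU lam_nov by simp
qed

end

section \<open>Levels and spectral numbers\<close>

lemma level_le_iff:
  assumes x: "x \<in> carrier Ch"
  shows "floer_level R c x \<le> ereal t \<longleftrightarrow> below t x"
proof (cases "x = \<zero>\<^bsub>Ch\<^esub>")
  case True
  then show ?thesis by (simp add: floer_level_def below_def Ch_zero_apply)
next
  case False
  then obtain q0 where q0: "q0 \<in> Pts" "x q0 \<noteq> \<zero>"
    using chain_eqI[OF x Ch_zero_closed] Ch_zero_apply by metis
  let ?V = "action c ` {p \<in> Pts. x p \<noteq> \<zero>}"
  let ?W = "action c ` {p \<in> Pts. x p \<noteq> \<zero> \<and> action c p > action c q0 - 1}"
  have W: "finite ?W" "action c q0 \<in> ?W" using chain_finite[OF x] q0 by auto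
  define M where "M = Max ?W"
  have MW: "M \<in> ?W" unfolding M_def using W by (intro Max_in) auto
  have M_ge: "v \<le> M" if "v \<in> ?V" for v
  proof (cases "v > action c q0 - 1")
    case True
    then have "v \<in> ?W" using that by auto
    then show ?thesis unfolding M_def using W(1) by (intro Max_ge)
  next
    case False
    moreover have "action c q0 \<le> M" unfolding M_def using W by (intro Max_ge)
    ultimately show ?thesis by simp
  qed
  have "(GREATEST v. v \<in> ?V) = M"
    using MW M_ge by (intro Greatest_equality) auto
  then have lev: "floer_level R c x = ereal M" using False by (simp add: floer_level_def)
  show ?thesis
  proof
    assume "floer_level R c x \<le> ereal t"
    then have "M \<le> t" using lev by simp
    then show "below t x" using M_ge unfolding below_def by force
  next
    assume "below t x"
    moreover obtain p where "p \<in> Pts" "x p \<noteq> \<zero>" "M = action c p" using MW by auto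
    ultimately have "M \<le> t" unfolding below_def by force
    then show "floer_level R c x \<le> ereal t" using lev by simp
  qed
qed

text \<open>
An irreducible element has the least level in its coset.  If there is none, the coset is \<open>U\<close>, and
zero is the best representative.
\<close>

theorem best_representative:
  assumes U: "Ch.op_subgroup {} U"
    and smult_U: "\<And>b u. b \<in> carrier Nov \<Longrightarrow> u \<in> U \<Longrightarrow> b \<odot>\<^bsub>Ch\<^esub> u \<in> U"
    and x: "x \<in> carrier Ch"
  shows "\<exists>y\<in>carrier Ch. x \<ominus>\<^bsub>Ch\<^esub> y \<in> U \<and>
    (\<forall>z\<in>carrier Ch. x \<ominus>\<^bsub>Ch\<^esub> z \<in> U \<longrightarrow> floer_level R c y \<le> floer_level R c z)"
proof (cases "\<forall>y s. y \<in> carrier Ch \<longrightarrow> x \<ominus>\<^bsub>Ch\<^esub> y \<in> U \<longrightarrow> below s y \<longrightarrow>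
      (\<exists>u\<in>U. below s u \<and> slice s u = slice s y)")
  case True
  then have "x \<in> U" by (intro reducible_imp_mem[OF U smult_U x]) simp_all
  moreover have "x \<ominus>\<^bsub>Ch\<^esub> \<zero>\<^bsub>Ch\<^esub> = x" using x by (simp add: Ch.minus_eq)
  ultimately show ?thesis
    by (intro bexI[of _ "\<zero>\<^bsub>Ch\<^esub>"]) (simp_all add: floer_level_def Ch_zero_closed)
next
  case False
  then obtain y s where y: "y \<in> carrier Ch" "x \<ominus>\<^bsub>Ch\<^esub> y \<in> U" "below s y"
    and irred: "\<And>u. u \<in> U \<Longrightarrow> below s u \<Longrightarrow> slice s u \<noteq> slice s y" by blast
  have "floer_level R c y \<le> floer_level R c z" if z: "z \<in> carrier Ch" "x \<ominus>\<^bsub>Ch\<^esub> z \<in> U" for z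
  proof (rule ereal_le_real)
    fix t assume "floer_level R c z \<le> ereal t"
    then have zt: "below t z" using level_le_iff[OF z(1)] by simp
    \<comment> \<open>Otherwise \<open>y - z\<close> is an element of \<open>U\<close> with the same leading slice as \<open>y\<close>.\<close>
    have "s \<le> t"
    proof (rule ccontr)
      assume "\<not> s \<le> t"
      then have z0: "z q = \<zero>" if "q \<in> Pts" "action c q \<ge> s" for q
        using zt that by (simp add: below_def)
      have "(x \<ominus>\<^bsub>Ch\<^esub> z) \<ominus>\<^bsub>Ch\<^esub> (x \<ominus>\<^bsub>Ch\<^esub> y) \<in> U" using Ch.op_subgroupD(3)[OF U z(2) y(2)] .
      moreover have "(x \<ominus>\<^bsub>Ch\<^esub> z) \<ominus>\<^bsub>Ch\<^esub> (x \<ominus>\<^bsub>Ch\<^esub> y) = y \<ominus>\<^bsub>Ch\<^esub> z"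
        using x y(1) z(1) Ch.minus_cancel_left[of x "\<ominus>\<^bsub>Ch\<^esub> z" "\<ominus>\<^bsub>Ch\<^esub> y"]
        by (simp add: Ch.minus_eq Ch.a_comm)
      ultimately have u: "y \<ominus>\<^bsub>Ch\<^esub> z \<in> U" by simp
      have yz: "(y \<ominus>\<^bsub>Ch\<^esub> z) q = y q" if "q \<in> Pts" "action c q \<ge> s" for q
        using Ch_minus_apply[OF y(1) z(1) that(1)] z0[OF that] chain_coeff[OF y(1) that(1)]
        by (simp add: minus_eq)
      have "below s (y \<ominus>\<^bsub>Ch\<^esub> z)" using y(3) yz by (simp add: below_def)
      moreover have "slice s (y \<ominus>\<^bsub>Ch\<^esub> z) = slice s y"
        using yz by (intro ext) (simp add: slice_def restrict_def)
      ultimately show False using irred[OF u] by blast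
    qed
    then show "floer_level R c y \<le> ereal t"
      using below_mono[OF y(3)] level_le_iff[OF y(1)] by blast
  qed
  then show ?thesis using y by blast
qed

abbreviation "D \<equiv> floer_boundary R c"
abbreviation "boundaries \<equiv> D ` carrier Ch"

lemma boundary: "is_floer_boundary R c D"
  unfolding floer_boundary_def using complexD(6) by (rule someI_ex)

lemma boundary_endo: "D \<in> Ch.endos"
  using boundary by (auto simp: is_floer_boundary_def module_homs_def hom_def)

lemma boundary_smult: "b \<in> carrier Nov \<Longrightarrow> x \<in> carrier Ch \<Longrightarrow> D (b \<odot>\<^bsub>Ch\<^esub> x) = b \<odot>\<^bsub>Ch\<^esub> D x"
  using boundary by (simp add: is_floer_boundary_def module_homs_def)

lemma boundary_boundary: "x \<in> carrier Ch \<Longrightarrow> D (D x) = \<zero>\<^bsub>Ch\<^esub>"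
  using boundary by (simp add: is_floer_boundary_def)

lemmas boundary_closed = Ch.endos_closed[OF boundary_endo]

lemma image_subgroup: "Ch.op_subgroup {} boundaries"
  unfolding Ch.op_subgroup_def
proof (intro conjI ballI)
  show "boundaries \<subseteq> carrier Ch" using boundary_closed by blast
  have "D \<zero>\<^bsub>Ch\<^esub> \<in> boundaries" using Ch_zero_closed by (rule imageI)
  then show "\<zero>\<^bsub>Ch\<^esub> \<in> boundaries" using Ch.endos_zero[OF boundary_endo] by simp
  fix x y assume "x \<in> boundaries" "y \<in> boundaries"
  then obtain v w where v: "v \<in> carrier Ch" "x = D v" "w \<in> carrier Ch" "y = D w" by blast
  have "D (v \<ominus>\<^bsub>Ch\<^esub> w) \<in> boundaries" using Ch.minus_closed[OF v(1,3)] by (rule imageI)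
  then show "x \<ominus>\<^bsub>Ch\<^esub> y \<in> boundaries" using Ch.endos_minus[OF boundary_endo v(1,3)] v(2,4) by simp
qed simp

lemma image_smult:
  assumes b: "b \<in> carrier Nov" and u: "u \<in> boundaries"
  shows "b \<odot>\<^bsub>Ch\<^esub> u \<in> boundaries"
proof -
  obtain w where w: "w \<in> carrier Ch" "u = D w" using u by blast
  have "D (b \<odot>\<^bsub>Ch\<^esub> w) \<in> boundaries" using smult_closed[OF b w(1)] by (rule imageI)
  then show ?thesis using boundary_smult[OF b w(1)] w(2) by simp
qed

lemma class_eq: "floer_class R c x = {u \<oplus>\<^bsub>Ch\<^esub> x | u. u \<in> boundaries}"
  by (auto simp: floer_class_def a_r_coset_def')

lemma class_eq_iff:
  assumes x: "x \<in> carrier Ch" and y: "y \<in> carrier Ch"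
  shows "floer_class R c x = floer_class R c y \<longleftrightarrow> x \<ominus>\<^bsub>Ch\<^esub> y \<in> boundaries"
proof
  note boundaries_closed = Ch.op_subgroupD(1)[OF image_subgroup, THEN subsetD]
  have "\<zero>\<^bsub>Ch\<^esub> \<oplus>\<^bsub>Ch\<^esub> x \<in> floer_class R c x"
    unfolding class_eq using Ch.op_subgroupD(2)[OF image_subgroup] by blast
  then have mem: "x \<in> floer_class R c x" using x by simp
  assume "floer_class R c x = floer_class R c y"
  then have "x \<in> floer_class R c y" using mem by simp
  then obtain u where u: "u \<in> boundaries" "x = u \<oplus>\<^bsub>Ch\<^esub> y" unfolding class_eq by blast
  then have "x \<ominus>\<^bsub>Ch\<^esub> y = u" using boundaries_closed[OF u(1)] y by (simp add: Ch.minus_eq Ch.a_assoc Ch.r_neg)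
  then show "x \<ominus>\<^bsub>Ch\<^esub> y \<in> boundaries" using u(1) by simp
next
  note boundaries_closed = Ch.op_subgroupD(1)[OF image_subgroup, THEN subsetD]
  have sub: "floer_class R c x \<subseteq> floer_class R c y"
    if "x \<in> carrier Ch" "y \<in> carrier Ch" "x \<ominus>\<^bsub>Ch\<^esub> y \<in> boundaries" for x y
  proof
    fix w assume "w \<in> floer_class R c x"
    then obtain u where u: "u \<in> boundaries" "w = u \<oplus>\<^bsub>Ch\<^esub> x" unfolding class_eq by blast
    have "w = (u \<oplus>\<^bsub>Ch\<^esub> (x \<ominus>\<^bsub>Ch\<^esub> y)) \<oplus>\<^bsub>Ch\<^esub> y"
      using u(2) boundaries_closed[OF u(1)] that(1,2) by (simp add: Ch.minus_eq Ch.a_assoc Ch.l_neg)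
    moreover have "u \<oplus>\<^bsub>Ch\<^esub> (x \<ominus>\<^bsub>Ch\<^esub> y) \<in> boundaries" using Ch.op_subgroup_add[OF image_subgroup u(1) that(3)] .
    ultimately show "w \<in> floer_class R c y" unfolding class_eq by blast
  qed
  assume d: "x \<ominus>\<^bsub>Ch\<^esub> y \<in> boundaries"
  have "\<zero>\<^bsub>Ch\<^esub> \<ominus>\<^bsub>Ch\<^esub> (x \<ominus>\<^bsub>Ch\<^esub> y) \<in> boundaries"
    using Ch.op_subgroupD(3)[OF image_subgroup Ch.op_subgroupD(2)[OF image_subgroup] d] .
  then have "y \<ominus>\<^bsub>Ch\<^esub> x \<in> boundaries" using x y by (simp add: Ch.minus_eq Ch.minus_add Ch.a_comm)
  then show "floer_class R c x = floer_class R c y" using sub x y d by blast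
qed

lemma carrier_subcomplex_homology:
  "carrier (subcomplex_homology R c V) = {D ` V +>\<^bsub>Ch\<^esub> x | x. x \<in> V \<and> D x = \<zero>\<^bsub>Ch\<^esub>}"
  by (auto simp: subcomplex_homology_def A_FactGroup_def FactGroup_def RCOSETS_def a_r_coset_def r_coset_def)

lemma inclusion_induced_coset:
  assumes V: "V \<subseteq> carrier Ch" "\<zero>\<^bsub>Ch\<^esub> \<in> V" and x: "x \<in> carrier Ch"
  shows "inclusion_induced R c (D ` V +>\<^bsub>Ch\<^esub> x) = floer_class R c x"
proof -
  have "floer_class R c (D v \<oplus>\<^bsub>Ch\<^esub> x) = floer_class R c x" if "v \<in> V" for v
  proof -
    have v: "v \<in> carrier Ch" using V that by blast
    then have "(D v \<oplus>\<^bsub>Ch\<^esub> x) \<ominus>\<^bsub>Ch\<^esub> x = D v"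
      using x boundary_closed[OF v] by (simp add: Ch.minus_eq Ch.a_assoc Ch.r_neg)
    then show ?thesis using class_eq_iff[of "D v \<oplus>\<^bsub>Ch\<^esub> x" x] x v boundary_closed[OF v] by simp
  qed
  moreover have "D ` V +>\<^bsub>Ch\<^esub> x = {D v \<oplus>\<^bsub>Ch\<^esub> x | v. v \<in> V}" by (auto simp: a_r_coset_def')
  ultimately show ?thesis using V(2) unfolding inclusion_induced_def by auto
qed

text \<open>
The spectral number is thus the infimum of the levels of the cycles in the class \<open>a\<close>.
\<close>

lemma inclusion_induced_iff:
  "a \<in> inclusion_induced R c ` carrier (filtered_homology R c t) \<longleftrightarrow>
    (\<exists>x\<in>carrier Ch. D x = \<zero>\<^bsub>Ch\<^esub> \<and> floer_class R c x = a \<and> floer_level R c x \<le> ereal t)"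
proof -
  let ?V = "filtered_chains R c t"
  have V: "?V \<subseteq> carrier Ch" "\<zero>\<^bsub>Ch\<^esub> \<in> ?V"
    using Ch_zero_closed by (auto simp: filtered_chains_def floer_level_def)
  have "inclusion_induced R c ` carrier (filtered_homology R c t) = {floer_class R c x | x. x \<in> ?V \<and> D x = \<zero>\<^bsub>Ch\<^esub>}"
  proof -
    have "inclusion_induced R c ` carrier (filtered_homology R c t)
      = {inclusion_induced R c (D ` ?V +>\<^bsub>Ch\<^esub> x) | x. x \<in> ?V \<and> D x = \<zero>\<^bsub>Ch\<^esub>}"
      unfolding filtered_homology_def carrier_subcomplex_homology by auto
    also have "\<dots> = {floer_class R c x | x. x \<in> ?V \<and> D x = \<zero>\<^bsub>Ch\<^esub>}"
    proof (rule Collect_cong)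
      fix K
      have eq: "inclusion_induced R c (D ` ?V +>\<^bsub>Ch\<^esub> x) = floer_class R c x" if "x \<in> ?V" for x
        using inclusion_induced_coset[OF V] V(1) that by blast
      show "(\<exists>x. K = inclusion_induced R c (D ` ?V +>\<^bsub>Ch\<^esub> x) \<and> x \<in> ?V \<and> D x = \<zero>\<^bsub>Ch\<^esub>) \<longleftrightarrow>
        (\<exists>x. K = floer_class R c x \<and> x \<in> ?V \<and> D x = \<zero>\<^bsub>Ch\<^esub>)"
        using eq by (intro iff_exI) auto
    qed
    finally show ?thesis .
  qed
  then show ?thesis by (auto simp: filtered_chains_def)
qed

text \<open>
A best representative modulo boundaries of a cycle is again a cycle, since boundaries are cycles.
\<close>

theorem spectral_number_attained:
  assumes "a \<in> carrier (floer_homology R c)"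
  shows "\<exists>\<alpha>\<in>carrier Ch. D \<alpha> = \<zero>\<^bsub>Ch\<^esub> \<and> floer_class R c \<alpha> = a \<and> floer_level R c \<alpha> = spectral_number R c a"
proof -
  obtain x where x: "x \<in> carrier Ch" "D x = \<zero>\<^bsub>Ch\<^esub>" "a = floer_class R c x"
    using assms by (auto simp: floer_homology_def carrier_subcomplex_homology floer_class_def)
  obtain y where y: "y \<in> carrier Ch" "x \<ominus>\<^bsub>Ch\<^esub> y \<in> boundaries"
    and best: "\<And>z. z \<in> carrier Ch \<Longrightarrow> x \<ominus>\<^bsub>Ch\<^esub> z \<in> boundaries \<Longrightarrow> floer_level R c y \<le> floer_level R c z"
    using best_representative[OF image_subgroup image_smult x(1)] by blast
  have cls: "floer_class R c y = a" using class_eq_iff[OF x(1) y(1)] y(2) x(3) by simp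
  obtain w where "w \<in> carrier Ch" "x \<ominus>\<^bsub>Ch\<^esub> y = D w" using y(2) by (rule imageE)
  then have "D (x \<ominus>\<^bsub>Ch\<^esub> y) = \<zero>\<^bsub>Ch\<^esub>" using boundary_boundary by simp
  then have "D x \<ominus>\<^bsub>Ch\<^esub> D y = \<zero>\<^bsub>Ch\<^esub>" using Ch.endos_minus[OF boundary_endo x(1) y(1)] by simp
  then have cyc: "D y = \<zero>\<^bsub>Ch\<^esub>"
    using x(2) boundary_closed[OF y(1)] Ch.minus_add_cancel[OF boundary_closed[OF x(1)] boundary_closed[OF y(1)]]
    by simp
  let ?T = "{ereal t | t. a \<in> inclusion_induced R c ` carrier (filtered_homology R c t)}"
  have "floer_level R c y \<le> Inf ?T"
  proof (rule Inf_greatest)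
    fix r assume "r \<in> ?T"
    then obtain t z where z: "r = ereal t" "z \<in> carrier Ch" "floer_class R c z = a" "floer_level R c z \<le> ereal t"
      unfolding inclusion_induced_iff by blast
    have "x \<ominus>\<^bsub>Ch\<^esub> z \<in> boundaries" using class_eq_iff[OF x(1) z(2)] x(3) z(3) by simp
    then show "floer_level R c y \<le> r" using best[OF z(2)] z(1,4) order_trans by blast
  qed
  moreover have "Inf ?T \<le> floer_level R c y"
  proof (rule ereal_le_real)
    fix t assume "floer_level R c y \<le> ereal t"
    then have "ereal t \<in> ?T" unfolding inclusion_induced_iff using y(1) cyc cls by blast
    then show "Inf ?T \<le> ereal t" by (rule Inf_lower)
  qed
  ultimately have "floer_level R c y = spectral_number R c a"
    unfolding spectral_number_def by (rule antisym)
  then show ?thesis using y(1) cyc cls by blast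
qed

end

theorem theorem1p4:
  fixes R :: "('r, 'm) ring_scheme"
    and c :: "('r, 'g, 's, 'p) floer_novikov"
    and a :: "('p \<Rightarrow> 'r) set"
  assumes "cring R" and "noetherian_ring R"
    and "filtered_floer_novikov_complex R c"
    and "a \<in> carrier (floer_homology R c)"
  shows "\<exists>\<alpha>\<in>carrier (floer_chains R c).
           floer_boundary R c \<alpha> = \<zero>\<^bsub>floer_chains R c\<^esub> \<and>
           floer_class R c \<alpha> = a \<and>
           floer_level R c \<alpha> = spectral_number R c a"
proof -
  interpret cring R by (rule assms(1))
  interpret noetherian_ring R by (rule assms(2))
  interpret floer_complex R c by unfold_locales (rule assms(3))
  show ?thesis by (rule spectral_number_attained[OF assms(4)])
qed

end
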